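(* Let $d\ge2$, $p\in(p_c(d),1)$, and let $\beta,c_{11},c_{12},c_{15},c_{16}>0$ be constants. There exist constants $c_{13},c_{14},c>0$, depending only on $d,p,\beta,c_{11},c_{12},c_{15},c_{16}$, such that the following holds with $\Delta(L_0)=c_{13}\exp(-c_{14}L_0^\beta)$. Let $\rho\in(0,1)$, let $\ell_0\ge 3^{1/\beta}\vee100$ and $L_0\ge1$ be integers, and define $t=3\rho^{-1}\log\mathcal{C}_{d,\ell_0}$. Suppose that a collection of Bernoulli random variables $(\zeta_x)_{x\in\mathbb{L}_0}$ is $(L_0,\ell_0)$-approximable with decay exponent $\beta$ (and with the constants $c_{11},c_{12},c_{15},c_{16}$), with approximating fields $(\zeta_x^{(n)})_{x\in\mathbb{L}_0,n\ge0}$, such that for $\vartheta_{L_0}:=\mathbb{Q}_p[\zeta_0^{(0)}=1]$ one has $$\log\big(1+e^t(\vartheta_{L_0}+\Delta(L_0))\big)\le\log\mathcal{C}_{d,\ell_0}\qquad\text{and}\qquad t-t\rho-cL_0^\beta\le-3\log\mathcal{C}_{d,\ell_0}.$$ Let $(D_n)_{n\ge1}$ be any deterministic sequence of finite sets with $D_n\subseteq\mathbb{L}_n$ and $\lim_{n\to\infty}2^{-n}\log|D_n|=0$. Then for $\mathbb{Q}_p$-a.e. $\omega$, $$\sup_{x\in D_n}\ \sup_{\mathcal{T}\in\Lambda_{n,x}}\ \frac1{2^n}\sum_{m\in T_{(n)}}\zeta_{\mathcal{T}(m)}(\omega)<\rho\quad\text{for all but finitely many }n.$$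
   Context: Probability space: $\mathbb{E}_d$ is the set of nearest-neighbor edges of $\mathbb{Z}^d$; $(\Omega_{\mathrm{bond}},\mathcal{F}_{\mathrm{bond}},\mathbb{Q}_p)$ is $\{0,1\}^{\mathbb{E}_d}$ with the canonical $\sigma$-algebra and the product measure under which the coordinates $(\omega_e)_{e\in\mathbb E_d}$ are i.i.d. Bernoulli($p$); $p_c(d)$ is the critical parameter of Bernoulli bond percolation on $\mathbb{Z}^d$. For $A\subseteq\mathbb{Z}^d$, $E(A)$ is the set of nearest-neighbor edges with both endpoints in $A$, and for a set of edges $E$, $\mathcal{F}_E=\sigma(\omega_e:e\in E)$. $B(x,R)=\{y\in\mathbb{Z}^d:|y-x|_\infty\le R\}$. Scales and trees: for integers $L_0\ge1$, $\ell_0\ge100$, $n\ge0$ let $L_n=L_0\ell_0^n$ and $\mathbb{L}_n=L_n\mathbb{Z}^d$. Let $T_{(k)}=\{1,2\}^k$ ($T_{(0)}=\{\varnothing\}$), $T_n=\bigcup_{k=0}^nT_{(k)}$; for $m=(\xi_1,\dots,\xi_k)\in T_{(k)}$, $k<n$, its children are $m_1=(\xi_1,\dots,\xi_k,1)$ and $m_2=(\xi_1,\dots,\xi_k,2)$. A map $\mathcal{T}:T_n\to\mathbb{Z}^d$ is a proper tree embedding of $T_n$ with root $x\in\mathbb{L}_n$ if $\mathcal{T}(\varnothing)=x$; $\mathcal{T}(m)\in\mathbb{L}_{n-k}$ for all $0\le k\le n$, $m\in T_{(k)}$; and for all $0\le k<n$, $m\in T_{(k)}$: $|\mathcal{T}(m_1)-\mathcal{T}(m)|_\infty=L_{n-k}$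 and $|\mathcal{T}(m_2)-\mathcal{T}(m)|_\infty=2L_{n-k}$. $\Lambda_{n,x}$ is the set of all proper tree embeddings of $T_n$ rooted at $x\in\mathbb{L}_n$. Set $$\mathcal{C}_{d,\ell_0}=\big((2\ell_0+1)^d-(2\ell_0-1)^d\big)\big((4\ell_0+1)^d-(4\ell_0-1)^d\big).$$ Approximability: a collection $(\zeta_x)_{x\in\mathbb{L}_0}$ of Bernoulli ($\{0,1\}$-valued) random variables on $(\Omega_{\mathrm{bond}},\mathcal{F}_{\mathrm{bond}},\mathbb{Q}_p)$ is $(L_0,\ell_0)$-approximable with decay exponent $\beta$ (and constants $c_{11},c_{12},c_{15},c_{16}$) if there are collections of Bernoulli random variables $(\zeta_x^{(n)})_{x\in\mathbb{L}_0}$, $n\ge0$ (the approximating fields) on the same space such that: (1) for fixed $n$, the $(\zeta_x^{(n)})_{x\in\mathbb{L}_0}$ are identically distributed; (2) $\zeta_x^{(n)}$ is $\mathcal{F}_{E(B(x,3L_n))}$-measurable; (3) for all $n\ge0$, $x\in\mathbb{L}_0$ there is an event $E_{n,x}^\zeta\in\mathcal{F}_{\mathrm{bond}}$ with $\zeta_x^{(n)}=\zeta_x^{(n+1)}$ on $E_{n,x}^\zeta$ and $\mathbb{Q}_p[(E_{n,x}^\zeta)^c]\le c_{11}\exp(-c_{12}L_n^\beta)$; (4) for all $n\ge0$, $x\in\mathbb{L}_0$ there is an event $F_{n,x}^\zeta$ with $\zeta_x=\zeta_x^{(n)}$ on $F_{n,x}^\zeta$ and $\mathbb{Q}_p[(F_{n,x}^\zeta)^c]\le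 c_{15}\exp(-c_{16}L_n^\beta)$. *)

theory Defs
  imports "HOL-Probability.Probability"
begin

subsection \<open>Bernoulli bond percolation on the integer lattice\<close>

definition edges :: "(int ^ 'd) set set" where
  "edges = {{x, y} | x y. (\<Sum>i\<in>UNIV. \<bar>x $ i - y $ i\<bar>) = 1}"

definition edges_within :: "(int ^ 'd) set \<Rightarrow> (int ^ 'd) set set" where
  "edges_within A = {e \<in> edges. e \<subseteq> A}"

type_synonym 'd config = "(int ^ 'd) set \<Rightarrow> bool"

text \<open>An edge \<open>e\<close> has state 1 (is open) iff \<open>\<omega> e\<close> is true.\<close>

definition bond :: "real \<Rightarrow> 'd::finite config measure" where
  "bond p = PiM edges (\<lambda>_. measure_pmf (bernoulli_pmf p))"

definition bond_sigma :: "real \<Rightarrow> (int ^ 'd::finite) set set \<Rightarrow> 'd config measure" where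
  "bond_sigma p E =
     sigma (space (bond p)) {{\<omega> \<in> space (bond p). \<omega> e \<in> A} | e A. e \<in> E}"

definition open_cluster :: "'d::finite config \<Rightarrow> int ^ 'd \<Rightarrow> (int ^ 'd) set" where
  "open_cluster \<omega> x = {y. (x, y) \<in> {(u, v). {u, v} \<in> edges \<and> \<omega> {u, v}}\<^sup>*}"

definition theta :: "'d::finite itself \<Rightarrow> real \<Rightarrow> real" where
  "theta _ p =
     measure (bond p) {\<omega> \<in> space (bond p). infinite (open_cluster \<omega> (0 :: int ^ 'd))}"

definition p_crit :: "'d::finite itself \<Rightarrow> real" where
  "p_crit d = Sup {p \<in> {0..1}. theta d p = 0}"

subsection \<open>Scales and proper tree embeddings\<close>

definition linf :: "int ^ 'd \<Rightarrow> int" where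
  "linf x = Max (range (\<lambda>i. \<bar>x $ i\<bar>))"

definition lbox :: "int ^ 'd \<Rightarrow> nat \<Rightarrow> (int ^ 'd) set" where
  "lbox x R = {y. linf (y - x) \<le> int R}"

definition scale :: "nat \<Rightarrow> nat \<Rightarrow> nat \<Rightarrow> nat" where
  "scale L0 l0 n = L0 * l0 ^ n"

definition scaled_lattice :: "nat \<Rightarrow> nat \<Rightarrow> nat \<Rightarrow> (int ^ 'd) set" where
  "scaled_lattice L0 l0 n = range (\<lambda>z. int (scale L0 l0 n) *s z)"

definition tree_level :: "nat \<Rightarrow> nat list set" where
  "tree_level k = {m. length m = k \<and> set m \<subseteq> {1, 2}}"

definition tree :: "nat \<Rightarrow> nat list set" where
  "tree n = (\<Union>k\<le>n. tree_level k)"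

definition embeddings :: "nat \<Rightarrow> nat \<Rightarrow> nat \<Rightarrow> int ^ 'd \<Rightarrow> (nat list \<Rightarrow> int ^ 'd) set" where
  "embeddings L0 l0 n x =
     {\<T> \<in> tree n \<rightarrow>\<^sub>E UNIV.
        \<T> [] = x \<and>
        (\<forall>k\<le>n. \<forall>m\<in>tree_level k. \<T> m \<in> scaled_lattice L0 l0 (n - k)) \<and>
        (\<forall>k<n. \<forall>m\<in>tree_level k.
           linf (\<T> (m @ [1]) - \<T> m) = int (scale L0 l0 (n - k)) \<and>
           linf (\<T> (m @ [2]) - \<T> m) = 2 * int (scale L0 l0 (n - k)))}"

definition embedding_const :: "nat \<Rightarrow> nat \<Rightarrow> real" where
  "embedding_const d l0 =
     ((2 * real l0 + 1) ^ d - (2 * real l0 - 1) ^ d) *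
     ((4 * real l0 + 1) ^ d - (4 * real l0 - 1) ^ d)"

subsection \<open>Approximability\<close>

text \<open>
  \<open>approximable_by p L0 l0 \<beta> c11 c12 c15 c16 \<zeta> \<zeta>'\<close> says that the collection \<open>\<zeta>\<close> is
  approximable with decay exponent \<open>\<beta>\<close>, the approximating fields being \<open>\<zeta>' n\<close>. Collections
  indexed by the lattice of scale 0 are total functions whose values off that lattice are
  unconstrained.
\<close>

definition approximable_by ::
  "real \<Rightarrow> nat \<Rightarrow> nat \<Rightarrow> real \<Rightarrow> real \<Rightarrow> real \<Rightarrow> real \<Rightarrow> real \<Rightarrow>
   (int ^ 'd::finite \<Rightarrow> 'd config \<Rightarrow> nat) \<Rightarrow> (nat \<Rightarrow> int ^ 'd \<Rightarrow> 'd config \<Rightarrow> nat) \<Rightarrow> bool"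
where
  "approximable_by p L0 l0 \<beta> c11 c12 c15 c16 \<zeta> \<zeta>' \<longleftrightarrow>
     (\<forall>x\<in>scaled_lattice L0 l0 0. \<zeta> x \<in> bond p \<rightarrow>\<^sub>M count_space {0, 1}) \<and>
     (\<forall>n. \<forall>x\<in>scaled_lattice L0 l0 0. \<zeta>' n x \<in> bond p \<rightarrow>\<^sub>M count_space {0, 1}) \<and>
     (\<forall>n. \<forall>x\<in>scaled_lattice L0 l0 0. \<forall>y\<in>scaled_lattice L0 l0 0.
        distr (bond p) (count_space {0, 1}) (\<zeta>' n x) =
        distr (bond p) (count_space {0, 1}) (\<zeta>' n y)) \<and>
     (\<forall>n. \<forall>x\<in>scaled_lattice L0 l0 0.
        \<zeta>' n x \<in> bond_sigma p (edges_within (lbox x (3 * scale L0 l0 n)))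
          \<rightarrow>\<^sub>M count_space {0, 1}) \<and>
     (\<forall>n. \<forall>x\<in>scaled_lattice L0 l0 0. \<exists>E\<in>sets (bond p).
        (\<forall>\<omega>\<in>E. \<zeta>' n x \<omega> = \<zeta>' (n + 1) x \<omega>) \<and>
        measure (bond p) (space (bond p) - E) \<le>
          c11 * exp (- c12 * real (scale L0 l0 n) powr \<beta>)) \<and>
     (\<forall>n. \<forall>x\<in>scaled_lattice L0 l0 0. \<exists>F\<in>sets (bond p).
        (\<forall>\<omega>\<in>F. \<zeta> x \<omega> = \<zeta>' n x \<omega>) \<and>
        measure (bond p) (space (bond p) - F) \<le>
          c15 * exp (- c16 * real (scale L0 l0 n) powr \<beta>))"

end

theory Submission
  imports Defs "HOL-Real_Asymp.Real_Asymp"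
begin

text \<open>
  For a proper embedding of \<open>T\<^sub>n\<close>, the level-\<open>n\<close> fields on the leaves below the two children of
  the root live on disjoint edge sets, because a leaf is within \<open>3 L\<^sub>n\<close> of the root of its
  subtree while the two children are at distance at least \<open>100 L\<^sub>n\<close>. The exponential moment
  \<open>\<phi>\<^sub>n\<close> of the leaf sum of the \<open>n\<close>-th approximating field, maximised over embeddings of \<open>T\<^sub>n\<close>,
  therefore satisfies
  \<open>\<phi>\<^sub>n\<^sub>+\<^sub>1 \<le> \<phi>\<^sub>n\<^sup>2 + 2\<^sup>n\<^sup>+\<^sup>1 c\<^sub>1\<^sub>1 exp (t 2\<^sup>n\<^sup>+\<^sup>1 - c\<^sub>1\<^sub>2 L\<^sub>n\<^sup>\<beta>)\<close>, the error coming from replacing the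
  field of index \<open>n + 1\<close> by the one of index \<open>n\<close>. Since \<open>L\<^sub>n\<^sup>\<beta> \<ge> 3\<^sup>n L\<^sub>0\<^sup>\<beta>\<close> and \<open>t \<le> c L\<^sub>0\<^sup>\<beta>\<close>, the errors are
  summable and \<open>\<phi>\<^sub>n\<close> is at most \<open>C\<close> to the power \<open>2\<^sup>n\<close>. There are at most as many embeddings with a
  given root, and \<open>exp (- t \<rho>)\<close> is \<open>C\<close> to the power \<open>-3\<close>, so a union bound, Markov's inequality
  and the Borel-Cantelli lemma conclude.
\<close>

subsection \<open>Counting proper embeddings\<close>

lemma linf_le_iff: "linf (x :: int ^ 'd::finite) \<le> r \<longleftrightarrow> (\<forall>i. \<bar>x $ i\<bar> \<le> r)"
  by (auto simp: linf_def)

lemma abs_nth_le_linf: "\<bar>(x :: int ^ 'd::finite) $ i\<bar> \<le> linf x"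
  using linf_le_iff by blast

lemma linf_triangle: "linf (x + y :: int ^ 'd::finite) \<le> linf x + linf y"
  unfolding linf_le_iff
proof
  fix i
  show "\<bar>(x + y) $ i\<bar> \<le> linf x + linf y"
    using abs_nth_le_linf[of x i] abs_nth_le_linf[of y i] by simp
qed

lemma linf_diff_triangle: "linf (x - z :: int ^ 'd::finite) \<le> linf (x - y) + linf (y - z)"
  using linf_triangle[of "x - y" "y - z"] by simp

lemma linf_minus_commute: "linf (x - y :: int ^ 'd::finite) = linf (y - x)"
  by (simp add: linf_def abs_minus_commute)

lemma linf_scale: "linf (int k *s x :: int ^ 'd::finite) = int k * linf x"
proof (rule antisym)
  show "linf (int k *s x) \<le> int k * linf x"
    by (auto simp: linf_le_iff abs_mult intro!: mult_left_mono abs_nth_le_linf)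
  have "linf x \<in> range (\<lambda>i. \<bar>x $ i\<bar>)"
    unfolding linf_def by (rule Max_in) auto
  then obtain i where "linf x = \<bar>x $ i\<bar>"
    by auto
  then show "int k * linf x \<le> linf (int k *s x)"
    using abs_nth_le_linf[of "int k *s x" i] by (simp add: abs_mult)
qed

lemma finite_card_linf_ball:
  "finite {z :: int ^ 'd::finite. linf z \<le> int r} \<and>
   card {z :: int ^ 'd. linf z \<le> int r} = (2 * r + 1) ^ CARD('d)"
proof -
  let ?P = "(UNIV :: 'd set) \<rightarrow>\<^sub>E {- int r..int r}"
  have *: "bij_betw vec_nth {z :: int ^ 'd. linf z \<le> int r} ?P"
  proof (rule bij_betwI[where g = vec_lambda])
    show "vec_nth \<in> {z :: int ^ 'd. linf z \<le> int r} \<rightarrow> ?P"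
      by (auto simp: linf_le_iff PiE_def abs_le_iff minus_le_iff)
    show "vec_lambda \<in> ?P \<rightarrow> {z :: int ^ 'd. linf z \<le> int r}"
      by (auto simp: linf_le_iff PiE_def Pi_iff abs_le_iff minus_le_iff)
  qed auto
  have "finite ?P"
    by (intro finite_PiE) auto
  moreover have "card ?P = (2 * r + 1) ^ CARD('d)"
    by (simp add: card_PiE nat_add_distrib nat_mult_distrib algebra_simps)
  ultimately show ?thesis
    using bij_betw_finite[OF *] bij_betw_same_card[OF *] by simp
qed

text \<open>The sphere is the difference of the concentric balls of radii \<open>r\<close> and
  \<open>r - 1\<close>. The bound \<open>r \<ge> 1\<close> keeps the natural subtraction exact, so
  that the inner ball has side 2 r - 1.\<close>

lemma finite_card_linf_sphere:
  assumes "r \<ge> 1"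
  shows "finite {z :: int ^ 'd::finite. linf z = int r}"
    and "real (card {z :: int ^ 'd. linf z = int r}) =
      (2 * real r + 1) ^ CARD('d) - (2 * real r - 1) ^ CARD('d)"
proof -
  let ?B = "\<lambda>r. {z :: int ^ 'd. linf z \<le> int r}"
  have eq: "{z :: int ^ 'd. linf z = int r} = ?B r - ?B (r - 1)"
    using assms by (auto simp: of_nat_diff)
  show "finite {z :: int ^ 'd. linf z = int r}"
    unfolding eq using finite_card_linf_ball[of r, where 'd = 'd] by blast
  have sub: "?B (r - 1) \<subseteq> ?B r"
    using assms by (auto simp: of_nat_diff)
  have "real (card (?B r - ?B (r - 1))) = real (card (?B r)) - real (card (?B (r - 1)))"
    using card_Diff_subset[OF _ sub] card_mono[OF _ sub] finite_card_linf_ball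
    by (metis of_nat_diff)
  then show "real (card {z :: int ^ 'd. linf z = int r}) =
      (2 * real r + 1) ^ CARD('d) - (2 * real r - 1) ^ CARD('d)"
    unfolding eq finite_card_linf_ball[THEN conjunct2]
    using assms by (simp add: of_nat_diff algebra_simps)
qed

lemma scale_Suc: "scale L0 l0 (Suc n) = l0 * scale L0 l0 n"
  by (simp add: scale_def)

text \<open>The centre is a multiple of L_{n+1} = l0 L_n, hence a point of the finer lattice.
  Shifting by it and dividing by L_n turns the set into the integer sphere of radius
  \<open>a * l0\<close>. The cases \<open>a = 1\<close> and \<open>a = 2\<close> yield the two
  factors of \<open>embedding_const\<close>.\<close>

lemma finite_card_lattice_sphere:
  fixes x :: "int ^ 'd::finite"
  assumes x: "x \<in> scaled_lattice L0 l0 (Suc n)" and "L0 \<ge> 1" "l0 \<ge> 1" "a \<ge> 1"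
  defines "S \<equiv> {y \<in> scaled_lattice L0 l0 n. linf (y - x) = int a * int (scale L0 l0 (Suc n))}"
  shows "finite S"
    and "real (card S) =
      (2 * real (a * l0) + 1) ^ CARD('d) - (2 * real (a * l0) - 1) ^ CARD('d)"
proof -
  let ?s = "scale L0 l0 n"
  let ?Z = "{z :: int ^ 'd. linf z = int (a * l0)}"
  have s: "?s \<ge> 1"
    using assms by (simp add: scale_def)
  obtain z0 where z0: "x = int (scale L0 l0 (Suc n)) *s z0"
    using x by (auto simp: scaled_lattice_def)
  let ?f = "\<lambda>z. x + int ?s *s z"
  have S: "S = ?f ` ?Z"
  proof (intro equalityI subsetI)
    fix y assume "y \<in> S"
    then obtain z where z: "y = int ?s *s z" "linf (y - x) = int a * int (scale L0 l0 (Suc n))"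
      by (auto simp: S_def scaled_lattice_def)
    have d: "y - x = int ?s *s (z - int l0 *s z0)"
      by (simp add: z z0 scale_Suc vec_eq_iff algebra_simps)
    have "int ?s * linf (z - int l0 *s z0) = int ?s * int (a * l0)"
      using z(2) unfolding d linf_scale by (simp add: scale_Suc mult_ac)
    then have "z - int l0 *s z0 \<in> ?Z"
      using s by simp
    moreover have "y = ?f (z - int l0 *s z0)"
      unfolding d[symmetric] by simp
    ultimately show "y \<in> ?f ` ?Z"
      by blast
  next
    fix y assume "y \<in> ?f ` ?Z"
    then obtain z where z: "y = ?f z" "z \<in> ?Z"
      by blast
    have "y = int ?s *s (int l0 *s z0 + z)"
      by (simp add: z z0 scale_Suc vec_eq_iff algebra_simps)
    then have "y \<in> scaled_lattice L0 l0 n"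
      unfolding scaled_lattice_def by blast
    then show "y \<in> S"
      using z by (simp add: S_def linf_scale scale_Suc mult_ac)
  qed
  have "inj ?f"
    using s by (auto simp: inj_def vec_eq_iff)
  then have "card S = card ?Z"
    unfolding S by (intro card_image) (auto intro: inj_on_subset)
  moreover have "a * l0 \<ge> 1"
    using assms by (simp add: Suc_le_eq)
  ultimately show "finite S"
    and "real (card S) =
      (2 * real (a * l0) + 1) ^ CARD('d) - (2 * real (a * l0) - 1) ^ CARD('d)"
    using finite_card_linf_sphere[of "a * l0", where 'd = 'd] S by auto
qed

text \<open>Each of the two factors is at least 2: split one factor off each power and use that the
  \<open>k\<close>-th power of \<open>a + 1\<close> dominates that of \<open>a - 1\<close> and is at
  least 1. The bound is what later makes the logarithm of the constant positive.\<close>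

lemma embedding_const_ge:
  assumes "d \<ge> 1" "l0 \<ge> 1"
  shows "embedding_const d l0 \<ge> 4"
proof -
  obtain k where d: "d = Suc k"
    using assms by (cases d) auto
  have *: "2 \<le> (a + 1) ^ d - (a - 1) ^ d" if "a \<ge> 1" for a :: real
  proof -
    have "1 \<le> (a + 1) ^ k" "(a - 1) ^ k \<le> (a + 1) ^ k"
      using that by (simp, intro power_mono) simp_all
    moreover from this have "(a - 1) * (a - 1) ^ k \<le> (a - 1) * (a + 1) ^ k"
      using that by (intro mult_left_mono) auto
    ultimately show ?thesis
      unfolding d power_Suc by (simp add: algebra_simps)
  qed
  have "2 * 2 \<le> embedding_const d l0"
    unfolding embedding_const_def using assms *[of "2 * real l0"] *[of "4 * real l0"]
    by (intro mult_mono) auto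
  then show ?thesis
    by simp
qed

section \<open>The binary tree and its splitting at the root\<close>

lemma tree_level_0 [simp]: "tree_level 0 = {[]}"
  by (auto simp: tree_level_def)

lemma tree_level_Suc: "tree_level (Suc n) = (#) 1 ` tree_level n \<union> (#) 2 ` tree_level n"
  by (auto simp: tree_level_def length_Suc_conv)

lemma finite_tree_level [simp]: "finite (tree_level n)"
  by (induction n) (auto simp: tree_level_Suc)

lemma sum_tree_level_Suc:
  "(\<Sum>m\<in>tree_level (Suc n). f m) =
   (\<Sum>m\<in>tree_level n. f (1 # m)) + (\<Sum>m\<in>tree_level n. f (2 # m))"
  unfolding tree_level_Suc
  by (subst sum.union_disjoint) (auto simp: sum.reindex)

lemma card_tree_level [simp]: "card (tree_level n) = 2 ^ n"
  by (induction n) (simp_all only: card_eq_sum sum_tree_level_Suc, auto)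

lemma tree_SucE:
  assumes "m \<in> tree (Suc n)"
  obtains "m = []" | m' where "m = 1 # m'" "m' \<in> tree n" | m' where "m = 2 # m'" "m' \<in> tree n"
  using assms by (cases m) (fastforce simp: tree_def tree_level_def)+

text \<open>The restriction is there because \<open>embeddings\<close> contains only functions that
  are undefined off the tree; without it the lower half of an embedding would not be an embedding of
  smaller depth.\<close>

definition subtree :: "nat \<Rightarrow> nat \<Rightarrow> (nat list \<Rightarrow> 'a) \<Rightarrow> nat list \<Rightarrow> 'a" where
  "subtree n a \<T> = restrict (\<lambda>m. \<T> (a # m)) (tree n)"

lemma subtree_apply [simp]: "m \<in> tree n \<Longrightarrow> subtree n a \<T> m = \<T> (a # m)"
  by (simp add: subtree_def)

lemma tree_level_subset_tree: "k \<le> n \<Longrightarrow> tree_level k \<subseteq> tree n"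
  by (auto simp: tree_def)

lemma Nil_in_tree [simp]: "[] \<in> tree n"
  using tree_level_subset_tree[of 0 n] by auto

text \<open>Level \<open>k\<close> of the subtree is level \<open>Suc k\<close> of the whole tree,
  and the depth drops by one as well, so the scale attached to each vertex stays the same.\<close>

lemma subtree_in_embeddings:
  assumes T: "\<T> \<in> embeddings L0 l0 (Suc n) x" and a: "a \<in> {1, 2}"
  shows "subtree n a \<T> \<in> embeddings L0 l0 n (\<T> [a])"
proof -
  have lev: "a # m \<in> tree_level (Suc k)" if "m \<in> tree_level k" for m k
    using that a by (auto simp: tree_level_Suc)
  have 1: "subtree n a \<T> m \<in> scaled_lattice L0 l0 (n - k)" if "k \<le> n" "m \<in> tree_level k" for k m
  proof -
    have "m \<in> tree n"
      using that tree_level_subset_tree by blast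
    moreover have "\<T> (a # m) \<in> scaled_lattice L0 l0 (Suc n - Suc k)"
      using T lev[OF that(2)] that(1) unfolding embeddings_def by blast
    ultimately show ?thesis
      by simp
  qed
  have 2: "linf (subtree n a \<T> (m @ [1]) - subtree n a \<T> m) = int (scale L0 l0 (n - k)) \<and>
        linf (subtree n a \<T> (m @ [2]) - subtree n a \<T> m) = 2 * int (scale L0 l0 (n - k))"
    if "k < n" "m \<in> tree_level k" for k m
  proof -
    have "m \<in> tree n" "m @ [1] \<in> tree n" "m @ [2] \<in> tree n"
      using that by (auto simp: tree_def tree_level_def)
    moreover have "linf (\<T> ((a # m) @ [1]) - \<T> (a # m)) = int (scale L0 l0 (Suc n - Suc k)) \<and>
        linf (\<T> ((a # m) @ [2]) - \<T> (a # m)) = 2 * int (scale L0 l0 (Suc n - Suc k))"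
      using T lev[OF that(2)] that(1) unfolding embeddings_def by blast
    ultimately show ?thesis
      by simp
  qed
  show ?thesis
    unfolding embeddings_def using 1 2 by (auto simp: subtree_def[of n a \<T>])
qed

lemma embeddings_root: "\<T> \<in> embeddings L0 l0 n x \<Longrightarrow> \<T> [] = x"
  by (simp add: embeddings_def)

lemma embeddings_leaf:
  "\<T> \<in> embeddings L0 l0 n x \<Longrightarrow> m \<in> tree_level n \<Longrightarrow> \<T> m \<in> scaled_lattice L0 l0 0"
  by (fastforce simp: embeddings_def)

lemma embeddings_children:
  assumes "\<T> \<in> embeddings L0 l0 (Suc n) x"
  shows "\<T> [1] \<in> scaled_lattice L0 l0 n" "\<T> [2] \<in> scaled_lattice L0 l0 n"
    and "linf (\<T> [1] - x) = int (scale L0 l0 (Suc n))"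
    and "linf (\<T> [2] - x) = 2 * int (scale L0 l0 (Suc n))"
proof -
  have "[1] \<in> tree_level (Suc 0)" "[2] \<in> tree_level (Suc 0)"
    by (auto simp: tree_level_def)
  then have "\<T> [1] \<in> scaled_lattice L0 l0 (Suc n - Suc 0) \<and>
      \<T> [2] \<in> scaled_lattice L0 l0 (Suc n - Suc 0)"
    using assms unfolding embeddings_def by auto
  then show "\<T> [1] \<in> scaled_lattice L0 l0 n" "\<T> [2] \<in> scaled_lattice L0 l0 n"
    by simp_all
  have "\<forall>m\<in>tree_level 0. linf (\<T> (m @ [1]) - \<T> m) = int (scale L0 l0 (Suc n - 0)) \<and>
      linf (\<T> (m @ [2]) - \<T> m) = 2 * int (scale L0 l0 (Suc n - 0))"
    using assms unfolding embeddings_def by blast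
  then show "linf (\<T> [1] - x) = int (scale L0 l0 (Suc n))"
    "linf (\<T> [2] - x) = 2 * int (scale L0 l0 (Suc n))"
    using embeddings_root[OF assms] by simp_all
qed

text \<open>An embedding is determined by the positions of the two children of the root and by its
  two subtrees. The children can be placed in C ways, whence N_{n+1} \<le> C N_n^2 with N_0 \<le> 1,
  and the exponents satisfy 1 + 2 (2^n - 1) = 2^{n+1} - 1.\<close>

lemma finite_card_embeddings:
  fixes x :: "int ^ 'd::finite"
  assumes "x \<in> scaled_lattice L0 l0 n" and L: "L0 \<ge> 1" "l0 \<ge> 1"
  shows "finite (embeddings L0 l0 n x) \<and>
    real (card (embeddings L0 l0 n x)) \<le> embedding_const CARD('d) l0 ^ (2 ^ n - 1)"
  using assms(1)
proof (induction n arbitrary: x)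
  case 0
  have "embeddings L0 l0 0 x \<subseteq> {restrict (\<lambda>_. x) {[]}}"
    by (auto simp: embeddings_def tree_def PiE_def extensional_def fun_eq_iff)
  then show ?case
    using card_mono[of "{restrict (\<lambda>_. x) {[]}}" "embeddings L0 l0 0 x"]
    by (auto intro: finite_subset)
next
  case (Suc n)
  let ?S = "\<lambda>a. {y \<in> scaled_lattice L0 l0 n. linf (y - x) = int a * int (scale L0 l0 (Suc n))}"
  let ?E = "embeddings L0 l0 n :: int ^ 'd \<Rightarrow> _"
  let ?C = "embedding_const CARD('d) l0"
  let ?K = "?C ^ (2 ^ n - 1)"
  have C: "?C \<ge> 4"
    using L by (intro embedding_const_ge) (simp_all add: Suc_le_eq)
  note S1 = finite_card_lattice_sphere[OF Suc.prems L order.refl]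
  have S2: "finite (?S 2)" "real (card (?S 2)) =
      (4 * real l0 + 1) ^ CARD('d) - (4 * real l0 - 1) ^ CARD('d)"
    using finite_card_lattice_sphere[OF Suc.prems L, of 2] by simp_all
  let ?P = "\<lambda>a. SIGMA y:?S a. ?E y"
  have P: "finite (?P a) \<and> real (card (?P a)) \<le> real (card (?S a)) * ?K" if "finite (?S a)" for a
  proof -
    have "real (card (?P a)) = (\<Sum>y\<in>?S a. real (card (?E y)))"
      using that Suc.IH by (subst card_SigmaI) auto
    also have "\<dots> \<le> (\<Sum>y\<in>?S a. ?K)"
      using Suc.IH by (intro sum_mono) auto
    finally show ?thesis
      using that Suc.IH by auto
  qed
  define f where "f = (\<lambda>\<T> :: nat list \<Rightarrow> int ^ 'd.
    ((\<T> [1], subtree n 1 \<T>), (\<T> [2], subtree n 2 \<T>)))"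
  have sub: "f ` embeddings L0 l0 (Suc n) x \<subseteq> ?P 1 \<times> ?P 2"
    using subtree_in_embeddings[of _ L0 l0 n x 1] subtree_in_embeddings[of _ L0 l0 n x 2]
      embeddings_children[of _ L0 l0 n x] by (auto simp: f_def)
  have inj: "inj_on f (embeddings L0 l0 (Suc n) x)"
  proof (rule inj_onI)
    fix \<T> \<U> assume TU: "\<T> \<in> embeddings L0 l0 (Suc n) x" "\<U> \<in> embeddings L0 l0 (Suc n) x"
      and "f \<T> = f \<U>"
    then have s: "subtree n 1 \<T> = subtree n 1 \<U>" "subtree n 2 \<T> = subtree n 2 \<U>"
      by (auto simp: f_def)
    have "\<T> m = \<U> m" if "m \<in> tree (Suc n)" for m
      using that
    proof (cases rule: tree_SucE)
      case 1
      then show ?thesis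
        using TU embeddings_root by metis
    next
      case (2 m')
      then show ?thesis
        using fun_cong[OF s(1), of m'] by simp
    next
      case (3 m')
      then show ?thesis
        using fun_cong[OF s(2), of m'] by simp
    qed
    then show "\<T> = \<U>"
      using TU by (intro PiE_ext[of \<T> "tree (Suc n)" "\<lambda>_. UNIV" \<U>]) (auto simp: embeddings_def)
  qed
  have fin: "finite (?P 1 \<times> ?P 2)"
    using P S1(1) S2(1) by blast
  have "finite (embeddings L0 l0 (Suc n) x)"
    using inj sub fin by (meson finite_imageD finite_subset)
  moreover have "real (card (embeddings L0 l0 (Suc n) x)) \<le> ?C ^ (2 ^ Suc n - 1)"
  proof -
    have "card (embeddings L0 l0 (Suc n) x) \<le> card (?P 1 \<times> ?P 2)"
      by (rule card_inj_on_le[OF inj sub fin])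
    then have "real (card (embeddings L0 l0 (Suc n) x)) \<le> real (card (?P 1)) * real (card (?P 2))"
      unfolding card_cartesian_product by (simp only: of_nat_le_iff flip: of_nat_mult)
    also have "\<dots> \<le> (real (card (?S 1)) * ?K) * (real (card (?S 2)) * ?K)"
      by (rule mult_mono[OF P[OF S1(1), THEN conjunct2] P[OF S2(1), THEN conjunct2]])
        (use C in simp_all)
    also have "\<dots> = ?C * (?K * ?K)"
      using S1(2) S2(2) by (simp add: embedding_const_def)
    also have "\<dots> = ?C ^ (1 + (2 ^ n - 1) + (2 ^ n - 1))"
      by (simp only: power_add power_one_right mult.assoc)
    also have "(1 + (2 ^ n - 1) + (2 ^ n - 1) :: nat) = 2 ^ Suc n - 1"
      using one_le_power[of "2::nat" n] by simp
    finally show ?thesis .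
  qed
  ultimately show ?case
    by blast
qed

subsection \<open>Separation of subtrees\<close>

text \<open>Going to a child costs at most 2 L_{n+1}, and everything below it at most 3 L_n \<le>
  L_{n+1}. The factor 3 therefore reproduces itself as soon as \<open>l0 \<ge> 3\<close>.\<close>

lemma embeddings_leaf_dist:
  fixes x :: "int ^ 'd::finite"
  assumes "\<T> \<in> embeddings L0 l0 n x" "m \<in> tree_level n" "l0 \<ge> 3"
  shows "linf (\<T> m - x) \<le> 3 * int (scale L0 l0 n)"
  using assms(1,2)
proof (induction n arbitrary: \<T> x m)
  case 0
  then show ?case
    using embeddings_root[OF 0(1)] by (simp add: linf_le_iff)
next
  case (Suc n)
  then obtain a m' where m: "m = a # m'" "m' \<in> tree_level n" "a = 1 \<or> a = 2"
    by (auto simp: tree_level_Suc)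
  then have "linf (subtree n a \<T> m' - \<T> [a]) \<le> 3 * int (scale L0 l0 n)"
    using Suc.IH[OF subtree_in_embeddings[OF Suc.prems(1)]] by auto
  then have "linf (\<T> m - \<T> [a]) \<le> 3 * int (scale L0 l0 n)"
    using m tree_level_subset_tree[of n n] by auto
  moreover have "linf (\<T> [a] - x) \<le> 2 * int (scale L0 l0 (Suc n))"
    using m(3) embeddings_children[OF Suc.prems(1)] by auto
  moreover have "3 * int (scale L0 l0 n) \<le> int (scale L0 l0 (Suc n))"
    using assms(3) by (simp add: scale_Suc mult_right_mono)
  ultimately show ?case
    using linf_diff_triangle[of "\<T> m" x "\<T> [a]"] by linarith
qed

text \<open>A vertex in both boxes would be within 3 L_n + 3 L_n of each child of the root, so the
  distances of the children from the root would differ by at most 12 L_n. They differ by L_{n+1}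
  \<ge> 100 L_n. Since edges are nonempty sets, disjoint boxes share no edge.\<close>

lemma embeddings_edges_disjoint:
  fixes x :: "int ^ 'd::finite"
  assumes T: "\<T> \<in> embeddings L0 l0 (Suc n) x" and L: "L0 \<ge> 1" "l0 \<ge> 100"
    and "m \<in> tree_level n" "m' \<in> tree_level n"
  shows "edges_within (lbox (\<T> (1 # m)) (3 * scale L0 l0 n)) \<inter>
    edges_within (lbox (\<T> (2 # m')) (3 * scale L0 l0 n)) = {}"
proof -
  let ?s = "int (scale L0 l0 n)"
  have s: "?s \<ge> 1" "int (scale L0 l0 (Suc n)) \<ge> 100 * ?s"
    using L by (simp_all add: scale_Suc mult_right_mono) (simp add: scale_def Suc_le_eq)
  have near: "linf (y - \<T> [a]) \<le> 6 * ?s"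
    if "a \<in> {1, 2}" "m \<in> tree_level n" "y \<in> lbox (\<T> (a # m)) (3 * scale L0 l0 n)" for a m y
    using embeddings_leaf_dist[OF subtree_in_embeddings[OF T that(1)] that(2)] that(2,3) L
      tree_level_subset_tree[of n n] linf_diff_triangle[of y "\<T> [a]" "\<T> (a # m)"]
    by (auto simp: lbox_def)
  have False if "y \<in> lbox (\<T> (1 # m)) (3 * scale L0 l0 n)"
    "y \<in> lbox (\<T> (2 # m')) (3 * scale L0 l0 n)" for y
  proof -
    have "linf (y - \<T> [1]) \<le> 6 * ?s" "linf (y - \<T> [2]) \<le> 6 * ?s"
      using near that assms by auto
    moreover have "linf (\<T> [2] - x) \<le> linf (y - \<T> [2]) + (linf (y - \<T> [1]) + linf (\<T> [1] - x))"
      using linf_diff_triangle[of "\<T> [2]" x y] linf_diff_triangle[of y x "\<T> [1]"]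
        linf_minus_commute[of y "\<T> [2]"] by linarith
    ultimately show False
      using embeddings_children(3,4)[OF T] s by linarith
  qed
  moreover have "e \<noteq> {}" if "e \<in> edges" for e :: "(int ^ 'd) set"
    using that by (auto simp: edges_def)
  ultimately show ?thesis
    unfolding edges_within_def by blast
qed

subsection \<open>Independence in the bond model\<close>

text \<open>Independence amounts to the joint law being the product of the marginals, and the joint
  law of the coordinates is the product measure itself. This criterion is for nonempty index sets,
  so the empty one is settled from the definition.\<close>

lemma indep_vars_PiM_coordinates:
  assumes "\<And>i. prob_space (M i)"
  shows "prob_space.indep_vars (PiM I M) M (\<lambda>i \<omega>. \<omega> i) I"
proof -
  interpret prob_space "PiM I M"
    by (intro prob_space_PiM assms)
  show ?thesis
  proof (cases "I = {}")
    case True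
    show ?thesis
      unfolding indep_vars_def indep_sets_def by (simp add: True)
  next
    case False
    have "distr (PiM I M) (PiM I M) (\<lambda>\<omega>. \<lambda>i\<in>I. \<omega> i) = distr (PiM I M) (PiM I M) (\<lambda>\<omega>. \<omega>)"
      by (intro distr_cong) (auto simp: space_PiM PiE_def extensional_restrict)
    also have "\<dots> = PiM I (\<lambda>i. distr (PiM I M) (M i) (\<lambda>\<omega>. \<omega> i))"
      unfolding distr_id by (intro PiM_cong refl) (simp add: distr_PiM_component assms)
    finally show ?thesis
      by (subst indep_vars_iff_distr_eq_PiM'[OF False]) auto
  qed
qed

lemma prob_space_bond: "prob_space (bond p)"
  unfolding bond_def by (intro prob_space_PiM prob_space_measure_pmf)

interpretation bond: prob_space "bond p"
  by (rule prob_space_bond)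

lemma space_bond_sigma [simp]: "space (bond_sigma p E) = space (bond p)"
  unfolding bond_sigma_def by (rule space_measure_of) auto

lemma sets_bond_sigma:
  "sets (bond_sigma p E) =
     sigma_sets (space (bond p)) (\<Union>e\<in>E. {{\<omega> \<in> space (bond p). \<omega> e \<in> A} | A. True})"
proof -
  have "{{\<omega> \<in> space (bond p). \<omega> e \<in> A} | e A. e \<in> E} =
      (\<Union>e\<in>E. {{\<omega> \<in> space (bond p). \<omega> e \<in> A} | A. True})"
    by auto
  then show ?thesis
    unfolding bond_sigma_def by (subst sets_measure_of) auto
qed

lemma measurable_bond_sigma_mono:
  assumes "f \<in> bond_sigma p E \<rightarrow>\<^sub>M N" "E \<subseteq> E'"
  shows "f \<in> bond_sigma p E' \<rightarrow>\<^sub>M N"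
proof -
  have "sets (bond_sigma p E) \<subseteq> sets (bond_sigma p E')"
    unfolding sets_bond_sigma using assms(2) by (intro sigma_sets_mono') blast
  then show ?thesis
    using assms(1) by (auto simp: measurable_def)
qed

text \<open>Independent coordinates remain independent when grouped into disjoint blocks. The
  grouping needs generators closed under intersection, which holds since the constraint on a single
  edge ranges over all sets \<open>A\<close> of states.\<close>

lemma indep_set_bond_sigma:
  fixes E E' :: "(int ^ 'd::finite) set set"
  assumes "E \<subseteq> edges" "E' \<subseteq> edges" "E \<inter> E' = {}"
  shows "bond.indep_set p (sets (bond_sigma p E)) (sets (bond_sigma p E'))"
proof -
  let ?G = "\<lambda>e. {{\<omega> \<in> space (bond p). \<omega> e \<in> A} | A. True}"
  have "bond.indep_vars p (\<lambda>_. measure_pmf (bernoulli_pmf p)) (\<lambda>e \<omega>. \<omega> e)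
      (edges :: (int ^ 'd) set set)"
    using indep_vars_PiM_coordinates[of "\<lambda>_. measure_pmf (bernoulli_pmf p)"
        "edges :: (int ^ 'd) set set"]
    by (simp add: bond_def prob_space_measure_pmf)
  then have "bond.indep_sets p (\<lambda>e. {(\<lambda>\<omega>. \<omega> e) -` A \<inter> space (bond p) | A. A \<in> UNIV})
      (edges :: (int ^ 'd) set set)"
    by (simp add: bond.indep_vars_def2)
  also have "(\<lambda>e. {(\<lambda>\<omega>. \<omega> e) -` A \<inter> space (bond p) | A. A \<in> UNIV}) = ?G"
    by (auto simp: fun_eq_iff vimage_def Int_def conj_commute)
  finally have "bond.indep_sets p ?G (\<Union>b\<in>UNIV. case_bool E E' b)"
    using assms by (elim bond.indep_sets_mono_index[rotated]) (auto split: bool.splits)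
  then have "bond.indep_sets p
      (\<lambda>b. sigma_sets (space (bond p)) (\<Union>e\<in>case_bool E E' b. ?G e)) UNIV"
  proof (rule bond.indep_sets_collect_sigma)
    fix b e
    show "Int_stable (?G e)"
    proof (rule Int_stableI, safe)
      fix A B
      show "\<exists>A'. {\<omega> \<in> space (bond p). \<omega> e \<in> A} \<inter> {\<omega> \<in> space (bond p). \<omega> e \<in> B} =
          {\<omega> \<in> space (bond p). \<omega> e \<in> A'} \<and> True"
        by (rule exI[of _ "A \<inter> B"]) auto
    qed
  next
    show "disjoint_family_on (case_bool E E') UNIV"
      using assms(3) by (auto simp: disjoint_family_on_def split: bool.splits)
  qed
  then show ?thesis
    unfolding bond.indep_set_def sets_bond_sigma
    by (elim bond.indep_sets_mono_sets) (auto split: bool.splits)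
qed

text \<open>Independent families consist of events by definition, so independence from the trivial
  sigma-algebra of the empty edge set already gives the inclusion.\<close>

lemma sets_bond_sigma_subset:
  assumes "E \<subseteq> edges"
  shows "sets (bond_sigma p E) \<subseteq> sets (bond p)"
  using bond.indep_setD_ev1[OF indep_set_bond_sigma[of E "{}" p]] assms by auto

lemma measurable_bond_sigmaD:
  assumes "f \<in> bond_sigma p E \<rightarrow>\<^sub>M N" "E \<subseteq> edges"
  shows "f \<in> bond p \<rightarrow>\<^sub>M N"
  using assms(1) sets_bond_sigma_subset[OF assms(2), of p]
  unfolding measurable_def space_bond_sigma by blast

lemma generated_sigma_subset_bond_sigma:
  assumes "X \<in> bond_sigma p E \<rightarrow>\<^sub>M N"
  shows "sigma_sets (space (bond p)) {X -` A \<inter> space (bond p) | A. A \<in> sets N} \<subseteq>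
    sets (bond_sigma p E)"
proof -
  have "{X -` A \<inter> space (bond p) | A. A \<in> sets N} \<subseteq> sets (bond_sigma p E)"
    using measurable_sets[OF assms] by auto
  from sets.sigma_sets_subset[OF this] show ?thesis
    by simp
qed

lemma indep_var_bond_sigma:
  assumes X: "X \<in> bond_sigma p E \<rightarrow>\<^sub>M N" and Y: "Y \<in> bond_sigma p E' \<rightarrow>\<^sub>M N'"
    and E: "E \<subseteq> edges" "E' \<subseteq> edges" "E \<inter> E' = {}"
  shows "bond.indep_var p N X N' Y"
  unfolding bond.indep_var_eq
proof (intro conjI)
  show "X \<in> bond p \<rightarrow>\<^sub>M N" "Y \<in> bond p \<rightarrow>\<^sub>M N'"
    using measurable_bond_sigmaD X Y E by blast+
  show "bond.indep_set p
      (sigma_sets (space (bond p)) {X -` A \<inter> space (bond p) | A. A \<in> sets N})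
      (sigma_sets (space (bond p)) {Y -` A \<inter> space (bond p) | A. A \<in> sets N'})"
    unfolding bond.indep_set_def
    by (rule bond.indep_sets_mono_sets[OF indep_set_bond_sigma[OF E, of p, unfolded bond.indep_set_def]],
        rename_tac b, case_tac b)
      (simp_all only: bool.case generated_sigma_subset_bond_sigma[OF X]
        generated_sigma_subset_bond_sigma[OF Y])
qed

subsection \<open>Inequalities and summability\<close>

text \<open>Strict bounds pass to a supremum only because it is attained. An empty index set, such
  as an empty \<open>D n\<close>, has supremum minus infinity, hence the last hypothesis.\<close>

lemma SUP_less_finite:
  fixes f :: "'a \<Rightarrow> ereal"
  assumes "finite A" "\<And>x. x \<in> A \<Longrightarrow> f x < c" "- \<infinity> < c"
  shows "(SUP x\<in>A. f x) < c"
proof (cases "A = {}")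
  case False
  then obtain x where "x \<in> A"
    by blast
  then show ?thesis
    using assms by (intro finite_imp_Sup_less[of _ "f x"]) auto
qed (use assms(3) in \<open>simp add: bot_ereal_def\<close>)

text \<open>Absorbs an additive error into the base of a power, so that in the recursion over scales
  the errors simply add up inside the base. Only one factor of the power has to be expanded, because
  \<open>b \<le> b * a ^ k\<close>.\<close>

lemma add_le_power_add:
  assumes "(a::real) \<ge> 1" "b \<ge> 0" "n \<ge> 1"
  shows "a ^ n + b \<le> (a + b) ^ n"
proof -
  obtain k where k: "n = Suc k"
    using assms by (cases n) auto
  have "a ^ n + b \<le> a * a ^ k + b * a ^ k"
    using assms mult_left_mono[of 1 "a ^ k" b] by (simp add: k)
  also have "\<dots> = (a + b) * a ^ k"
    by (simp add: algebra_simps)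
  also have "\<dots> \<le> (a + b) * (a + b) ^ k"
    using assms by (intro mult_left_mono power_mono) auto
  finally show ?thesis
    by (simp add: k)
qed

lemma edges_within_subset: "edges_within A \<subseteq> edges"
  by (auto simp: edges_within_def)

text \<open>Each scale contributes a further factor \<open>real l0 powr \<beta>\<close>. That this
  is at least 3, and so exceeds the branching number 2, is what makes the decay win over the growth
  of the tree.\<close>

lemma scale_powr_ge:
  assumes "3 \<le> real l0 powr \<beta>"
  shows "real L0 powr \<beta> * 3 ^ n \<le> real (scale L0 l0 n) powr \<beta>"
proof (induction n)
  case 0
  then show ?case
    by (simp add: scale_def)
next
  case (Suc n)
  then show ?case
    using mult_mono[OF assms Suc.IH] by (simp add: scale_Suc powr_mult mult_ac)
qed

text \<open>The exponent is what remains after a factor depending on \<open>L0\<close> has been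
  split off. The sum thus depends on \<open>c\<close> alone and can enter a constant chosen before
  \<open>L0\<close>.\<close>

lemma summable_moment_errors:
  assumes "(c::real) > 0"
  shows "summable (\<lambda>n. 2 ^ Suc n * exp (- c * (3 ^ n - 1)))"
proof (rule summable_comparison_test_bigo)
  show "summable (\<lambda>n. norm ((1 / 2) ^ n :: real))"
    by simp
  show "(\<lambda>n. 2 ^ Suc n * exp (- c * (3 ^ n - 1))) \<in> O(\<lambda>n. (1 / 2) ^ n)"
    using assms by real_asymp
qed

text \<open>The two terms are the contributions of the exponential moment and of the approximation
  error to the bad event at depth \<open>n\<close>, both already multiplied by the bounds for the
  number of roots and of embeddings.\<close>

lemma summable_tail_errors:
  assumes "(K::real) > 0" "c > 0"
  shows "summable (\<lambda>n. exp (- K * 2 ^ n) + exp (3 * K * 2 ^ n) * (2 ^ n * (c' * exp (- c * 3 ^ n))))"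
proof (rule summable_add)
  have *: "summable (\<lambda>n. norm ((1 / 2) ^ n :: real))"
    by simp
  have "(\<lambda>n. exp (- K * 2 ^ n)) \<in> O(\<lambda>n. (1 / 2) ^ n)"
    using assms by real_asymp
  then show "summable (\<lambda>n. exp (- K * 2 ^ n))"
    by (rule summable_comparison_test_bigo[OF *])
  have "(\<lambda>n. exp (3 * K * 2 ^ n) * (2 ^ n * exp (- c * 3 ^ n))) \<in> O(\<lambda>n. (1 / 2) ^ n)"
    using assms by real_asymp
  from summable_mult[OF summable_comparison_test_bigo[OF * this], of c']
  show "summable (\<lambda>n. exp (3 * K * 2 ^ n) * (2 ^ n * (c' * exp (- c * 3 ^ n))))"
    by (simp add: mult_ac)
qed

subsection \<open>Exponential moments along the tree\<close>

locale approximable_field =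
  fixes p \<beta> c11 c12 c15 c16 :: real and L0 l0 :: nat
    and \<zeta> :: "int ^ 'd::finite \<Rightarrow> 'd config \<Rightarrow> nat"
    and \<zeta>' :: "nat \<Rightarrow> int ^ 'd \<Rightarrow> 'd config \<Rightarrow> nat"
  assumes approx: "approximable_by p L0 l0 \<beta> c11 c12 c15 c16 \<zeta> \<zeta>'"
    and L0: "L0 \<ge> 1" and l0: "l0 \<ge> 100"
begin

abbreviation lat :: "(int ^ 'd) set" where
  "lat \<equiv> scaled_lattice L0 l0 0"

lemma zero_in_lat: "0 \<in> lat"
  unfolding scaled_lattice_def by (rule range_eqI[of _ _ 0]) simp

lemma field_measurable: "x \<in> lat \<Longrightarrow> (\<lambda>\<omega>. real (\<zeta> x \<omega>)) \<in> borel_measurable (bond p)"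
  and field'_measurable: "x \<in> lat \<Longrightarrow> (\<lambda>\<omega>. real (\<zeta>' n x \<omega>)) \<in> borel_measurable (bond p)"
  and field'_measurable_local: "x \<in> lat \<Longrightarrow> (\<lambda>\<omega>. real (\<zeta>' n x \<omega>)) \<in>
    borel_measurable (bond_sigma p (edges_within (lbox x (3 * scale L0 l0 n))))"
proof -
  have "real \<in> count_space {0, 1} \<rightarrow>\<^sub>M borel"
    by simp
  note * = measurable_compose[OF _ this]
  show "x \<in> lat \<Longrightarrow> (\<lambda>\<omega>. real (\<zeta> x \<omega>)) \<in> borel_measurable (bond p)"
    "x \<in> lat \<Longrightarrow> (\<lambda>\<omega>. real (\<zeta>' n x \<omega>)) \<in> borel_measurable (bond p)"
    "x \<in> lat \<Longrightarrow> (\<lambda>\<omega>. real (\<zeta>' n x \<omega>)) \<in>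
      borel_measurable (bond_sigma p (edges_within (lbox x (3 * scale L0 l0 n))))"
    using approx unfolding approximable_by_def by (blast intro: *)+
qed

lemma field'_01: "x \<in> lat \<Longrightarrow> \<omega> \<in> space (bond p) \<Longrightarrow> \<zeta>' n x \<omega> = 0 \<or> \<zeta>' n x \<omega> = 1"
proof -
  assume "x \<in> lat" "\<omega> \<in> space (bond p)"
  moreover from this have "\<zeta>' n x \<in> bond p \<rightarrow>\<^sub>M count_space {0, 1}"
    using approx unfolding approximable_by_def by blast
  ultimately show ?thesis
    using measurable_space[of "\<zeta>' n x" "bond p" "count_space {0, 1}" \<omega>] by auto
qed

lemma field'_distr:
  assumes "x \<in> lat"
  shows "bond.prob p {\<omega> \<in> space (bond p). \<zeta>' n x \<omega> = 1} =
    bond.prob p {\<omega> \<in> space (bond p). \<zeta>' n 0 \<omega> = 1}"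
proof -
  have m: "\<zeta>' n y \<in> bond p \<rightarrow>\<^sub>M count_space {0, 1}" if "y \<in> lat" for y
    using approx that unfolding approximable_by_def by blast
  have *: "bond.prob p {\<omega> \<in> space (bond p). \<zeta>' n y \<omega> = 1} =
      measure (distr (bond p) (count_space {0, 1}) (\<zeta>' n y)) {1}" if "y \<in> lat" for y
    by (subst measure_distr[OF m[OF that]]) (auto intro!: arg_cong[where f = "bond.prob p"])
  have "distr (bond p) (count_space {0, 1}) (\<zeta>' n x) =
      distr (bond p) (count_space {0, 1}) (\<zeta>' n 0)"
    using approx assms zero_in_lat unfolding approximable_by_def by blast
  then show ?thesis
    unfolding *[OF assms] *[OF zero_in_lat] by simp
qed

lemma field'_step:
  assumes "x \<in> lat"
  shows "\<exists>E\<in>sets (bond p). (\<forall>\<omega>\<in>E. \<zeta>' n x \<omega> = \<zeta>' (Suc n) x \<omega>) \<and>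
    bond.prob p (space (bond p) - E) \<le> c11 * exp (- c12 * real (scale L0 l0 n) powr \<beta>)"
  using approx[unfolded approximable_by_def, THEN conjunct2, THEN conjunct2, THEN conjunct2,
      THEN conjunct2, THEN conjunct1, rule_format, OF assms, of n] by (simp only: Suc_eq_plus1)

lemma field'_limit:
  assumes "x \<in> lat"
  shows "\<exists>F\<in>sets (bond p). (\<forall>\<omega>\<in>F. \<zeta> x \<omega> = \<zeta>' n x \<omega>) \<and>
    bond.prob p (space (bond p) - F) \<le> c15 * exp (- c16 * real (scale L0 l0 n) powr \<beta>)"
  using approx[unfolded approximable_by_def, THEN conjunct2, THEN conjunct2, THEN conjunct2,
      THEN conjunct2, THEN conjunct2, rule_format, OF assms, of n] .

definition mgf :: "real \<Rightarrow> nat \<Rightarrow> (nat list \<Rightarrow> int ^ 'd) \<Rightarrow> real" where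
  "mgf t n \<T> = bond.expectation p (\<lambda>\<omega>. exp (t * (\<Sum>m\<in>tree_level n. real (\<zeta>' n (\<T> m) \<omega>))))"

lemma sum_field'_bounds:
  assumes "finite I" "\<And>m. m \<in> I \<Longrightarrow> X m \<in> lat" "\<omega> \<in> space (bond p)"
  shows "0 \<le> (\<Sum>m\<in>I. real (\<zeta>' n (X m) \<omega>))" "(\<Sum>m\<in>I. real (\<zeta>' n (X m) \<omega>)) \<le> real (card I)"
proof -
  have "real (\<zeta>' n (X m) \<omega>) \<le> 1" if "m \<in> I" for m
    using field'_01[OF assms(2)[OF that] assms(3), of n] by auto
  then have "(\<Sum>m\<in>I. real (\<zeta>' n (X m) \<omega>)) \<le> (\<Sum>m\<in>I. 1)"
    by (rule sum_mono)
  then show "(\<Sum>m\<in>I. real (\<zeta>' n (X m) \<omega>)) \<le> real (card I)"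
    by simp
qed (simp add: sum_nonneg)

lemma integrable_exp_sum:
  assumes "finite I" "\<And>m. m \<in> I \<Longrightarrow> X m \<in> lat" "t \<ge> 0"
  shows "integrable (bond p) (\<lambda>\<omega>. exp (t * (\<Sum>m\<in>I. real (\<zeta>' n (X m) \<omega>))))"
proof (rule bond.integrable_const_bound[where B = "exp (t * real (card I))"])
  show "AE \<omega> in bond p. norm (exp (t * (\<Sum>m\<in>I. real (\<zeta>' n (X m) \<omega>)))) \<le> exp (t * real (card I))"
    using sum_field'_bounds[OF assms(1,2)] assms(3) by (intro AE_I2) (simp add: mult_left_mono)
  have "(\<lambda>\<omega>. \<Sum>m\<in>I. real (\<zeta>' n (X m) \<omega>)) \<in> borel_measurable (bond p)"
    using assms by (intro borel_measurable_sum field'_measurable) auto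
  then show "(\<lambda>\<omega>. exp (t * (\<Sum>m\<in>I. real (\<zeta>' n (X m) \<omega>)))) \<in> borel_measurable (bond p)"
    by measurable
qed

text \<open>At depth 0 the root is the only leaf, and exp (t z) \<le> 1 + exp t * z for z in {0, 1}.
  Identical distribution then moves the leaf to the origin.\<close>

lemma mgf_0:
  assumes "\<T> \<in> embeddings L0 l0 0 x" "t \<ge> 0"
  shows "mgf t 0 \<T> \<le> 1 + exp t * bond.prob p {\<omega> \<in> space (bond p). \<zeta>' 0 0 \<omega> = 1}"
proof -
  let ?A = "{\<omega> \<in> space (bond p). \<zeta>' 0 (\<T> []) \<omega> = 1}"
  have x: "\<T> [] \<in> lat"
    using embeddings_leaf[OF assms(1), of "[]"] by simp
  have A: "?A \<in> sets (bond p)"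
  proof -
    have "?A = (\<lambda>\<omega>. real (\<zeta>' 0 (\<T> []) \<omega>)) -` {1} \<inter> space (bond p)"
      by auto
    then show ?thesis
      using measurable_sets[OF field'_measurable[OF x, of 0], of "{1}"] by simp
  qed
  have int: "integrable (bond p) (indicator ?A :: _ \<Rightarrow> real)"
    using A by (rule integrable_real_indicator) (simp add: bond.emeasure_eq_measure)
  have "mgf t 0 \<T> \<le> bond.expectation p (\<lambda>\<omega>. 1 + exp t * indicator ?A \<omega>)"
    unfolding mgf_def
  proof (rule integral_mono)
    show "integrable (bond p) (\<lambda>\<omega>. exp (t * (\<Sum>m\<in>tree_level 0. real (\<zeta>' 0 (\<T> m) \<omega>))))"
      using x assms by (intro integrable_exp_sum) auto
    show "integrable (bond p) (\<lambda>\<omega>. 1 + exp t * indicator ?A \<omega>)"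
      using int by simp
    fix \<omega> :: "'d config" assume "\<omega> \<in> space (bond p)"
    then show "exp (t * (\<Sum>m\<in>tree_level 0. real (\<zeta>' 0 (\<T> m) \<omega>))) \<le> 1 + exp t * indicator ?A \<omega>"
      using field'_01[OF x, of \<omega> 0] by (auto simp: indicator_def)
  qed
  also have "\<dots> = 1 + exp t * bond.prob p ?A"
    using int by (simp add: bond.prob_space, intro arg_cong[where f = "bond.prob p"]) auto
  finally show ?thesis
    by (simp only: field'_distr[OF x])
qed

text \<open>The field has index \<open>n\<close> although the tree has depth \<open>Suc n\<close>.
  Its boxes are thus small enough for the leaves below the two children to depend on disjoint edge
  sets, and the exponential splits into independent factors.\<close>

lemma mgf_factor:
  assumes T: "\<T> \<in> embeddings L0 l0 (Suc n) x" and "t \<ge> 0"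
  shows "bond.expectation p (\<lambda>\<omega>. exp (t * (\<Sum>m\<in>tree_level (Suc n). real (\<zeta>' n (\<T> m) \<omega>)))) =
    mgf t n (subtree n 1 \<T>) * mgf t n (subtree n 2 \<T>)"
proof -
  let ?X = "\<lambda>a \<omega>. exp (t * (\<Sum>m\<in>tree_level n. real (\<zeta>' n (\<T> (a # m)) \<omega>)))"
  let ?E = "\<lambda>a. \<Union>m\<in>tree_level n. edges_within (lbox (\<T> (a # m)) (3 * scale L0 l0 n))"
  have lat: "\<T> (a # m) \<in> lat" if "a \<in> {1, 2}" "m \<in> tree_level n" for a m
    using that by (intro embeddings_leaf[OF T]) (auto simp: tree_level_Suc)
  have E: "?E a \<subseteq> edges" for a
    using edges_within_subset by blast
  have disj: "?E 1 \<inter> ?E 2 = {}"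
    using embeddings_edges_disjoint[OF T L0 l0] by blast
  have X: "?X a \<in> borel_measurable (bond_sigma p (?E a))" if a: "a \<in> {1, 2}" for a
  proof -
    have "(\<lambda>\<omega>. \<Sum>m\<in>tree_level n. real (\<zeta>' n (\<T> (a # m)) \<omega>)) \<in>
        borel_measurable (bond_sigma p (?E a))"
      using lat[OF a]
      by (intro borel_measurable_sum measurable_bond_sigma_mono[OF field'_measurable_local]) auto
    then show ?thesis
      by measurable
  qed
  have int: "integrable (bond p) (?X a)" if "a \<in> {1, 2}" for a
    using lat[OF that] assms by (intro integrable_exp_sum) auto
  have mgf: "mgf t n (subtree n a \<T>) = bond.expectation p (?X a)" for a
    unfolding mgf_def using tree_level_subset_tree[of n n]
    by (intro arg_cong[where f = "bond.expectation p"] ext arg_cong[where f = exp]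
        arg_cong[where f = "(*) t"] sum.cong) (auto simp: subset_iff)
  have "bond.expectation p (\<lambda>\<omega>. ?X 1 \<omega> * ?X 2 \<omega>) =
      bond.expectation p (?X 1) * bond.expectation p (?X 2)"
    by (intro bond.indep_var_lebesgue_integral indep_var_bond_sigma[OF X X E E disj] int) auto
  then show ?thesis
    by (simp add: mgf sum_tree_level_Suc distrib_left exp_add)
qed

text \<open>If every leaf lies in its agreement event, the fields of index \<open>n\<close> and
  \<open>Suc n\<close> have the same leaf sum. Otherwise \<open>?J\<close>, which counts the leaves
  outside their agreement events, is at least 1, and the exponential is at most
  \<open>exp (t * 2 ^ Suc n)\<close> because the leaf sum is at most the number of leaves.\<close>

lemma mgf_Suc:
  assumes T: "\<T> \<in> embeddings L0 l0 (Suc n) x" and t: "t \<ge> 0"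
  shows "mgf t (Suc n) \<T> \<le> mgf t n (subtree n 1 \<T>) * mgf t n (subtree n 2 \<T>) +
    2 ^ Suc n * (c11 * exp (t * 2 ^ Suc n - c12 * real (scale L0 l0 n) powr \<beta>))"
proof -
  let ?I = "tree_level (Suc n)"
  let ?S = "\<lambda>k \<omega>. \<Sum>m\<in>?I. real (\<zeta>' k (\<T> m) \<omega>)"
  have lat: "\<T> m \<in> lat" if "m \<in> ?I" for m
    using embeddings_leaf[OF T that] .
  have "\<forall>m\<in>?I. \<exists>E. E \<in> sets (bond p) \<and> (\<forall>\<omega>\<in>E. \<zeta>' n (\<T> m) \<omega> = \<zeta>' (Suc n) (\<T> m) \<omega>) \<and>
      bond.prob p (space (bond p) - E) \<le> c11 * exp (- c12 * real (scale L0 l0 n) powr \<beta>)"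
    using field'_step[OF lat, of _ n] by blast
  from bchoice[OF this] obtain E where E: "\<And>m. m \<in> ?I \<Longrightarrow> E m \<in> sets (bond p)"
      "\<And>m \<omega>. m \<in> ?I \<Longrightarrow> \<omega> \<in> E m \<Longrightarrow> \<zeta>' n (\<T> m) \<omega> = \<zeta>' (Suc n) (\<T> m) \<omega>"
      "\<And>m. m \<in> ?I \<Longrightarrow> bond.prob p (space (bond p) - E m) \<le>
        c11 * exp (- c12 * real (scale L0 l0 n) powr \<beta>)"
    by blast
  let ?J = "\<lambda>\<omega>. \<Sum>m\<in>?I. indicator (space (bond p) - E m) \<omega> :: real"
  let ?R = "\<lambda>\<omega>. exp (t * ?S n \<omega>) + exp (t * 2 ^ Suc n) * ?J \<omega>"
  have int: "integrable (bond p) (\<lambda>\<omega>. exp (t * ?S k \<omega>))" for k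
    using lat t by (intro integrable_exp_sum) auto
  have intJ: "integrable (bond p) (indicator (space (bond p) - E m) :: _ \<Rightarrow> real)" if "m \<in> ?I" for m
    using E(1)[OF that] by (auto simp: bond.emeasure_eq_measure)
  have intJ': "integrable (bond p) ?J"
    using intJ by (intro Bochner_Integration.integrable_sum) auto
  have "mgf t (Suc n) \<T> \<le> bond.expectation p ?R"
    unfolding mgf_def
  proof (rule integral_mono[OF int])
    show "integrable (bond p) ?R"
      using int intJ' by auto
    fix \<omega> :: "'d config" assume \<omega>: "\<omega> \<in> space (bond p)"
    show "exp (t * ?S (Suc n) \<omega>) \<le> ?R \<omega>"
    proof (cases "\<forall>m\<in>?I. \<omega> \<in> E m")
      case True
      then have "?S (Suc n) \<omega> = ?S n \<omega>"
        using E(2) by (intro sum.cong) auto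
      moreover have "?J \<omega> \<ge> 0"
        by (intro sum_nonneg) auto
      ultimately show ?thesis
        by simp
    next
      case False
      then obtain m where m: "m \<in> ?I" "\<omega> \<notin> E m"
        by blast
      have "indicator (space (bond p) - E m) \<omega> \<le> ?J \<omega>"
        by (rule member_le_sum[OF m(1)]) auto
      then have "1 \<le> ?J \<omega>"
        using m \<omega> by simp
      then have "exp (t * 2 ^ Suc n) * 1 \<le> exp (t * 2 ^ Suc n) * ?J \<omega>"
        by (intro mult_left_mono) auto
      moreover have "t * ?S (Suc n) \<omega> \<le> t * 2 ^ Suc n"
        using sum_field'_bounds(2)[of ?I \<T> \<omega> "Suc n"] lat \<omega> t
        by (intro mult_left_mono) auto
      then have "exp (t * ?S (Suc n) \<omega>) \<le> exp (t * 2 ^ Suc n)"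
        by simp
      ultimately show ?thesis
        using exp_ge_zero[of "t * ?S n \<omega>"] by linarith
    qed
  qed
  also have "\<dots> = mgf t n (subtree n 1 \<T>) * mgf t n (subtree n 2 \<T>) +
      exp (t * 2 ^ Suc n) * bond.expectation p ?J"
    using int intJ' by (simp only: mgf_factor[OF T t, symmetric] Bochner_Integration.integral_add
        Bochner_Integration.integral_mult_right integrable_mult_right)
  also have "bond.expectation p ?J = (\<Sum>m\<in>?I. bond.prob p (space (bond p) - E m))"
    using intJ E(1) by (subst Bochner_Integration.integral_sum) (auto intro!: sum.cong)
  also have "\<dots> \<le> (\<Sum>m\<in>?I. c11 * exp (- c12 * real (scale L0 l0 n) powr \<beta>))"
    using E(3) by (intro sum_mono) auto
  also have "\<dots> = 2 ^ Suc n * (c11 * exp (- c12 * real (scale L0 l0 n) powr \<beta>))"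
    by simp
  finally show ?thesis
    by (simp add: exp_diff exp_minus field_simps)
qed

text \<open>Squaring doubles the exponent, and \<open>add_le_power_add\<close> moves the new error
  into the base. This needs a base of at least 1, which the leading summand guarantees.\<close>

lemma mgf_bound:
  fixes \<epsilon> :: "nat \<Rightarrow> real"
  assumes T: "\<T> \<in> embeddings L0 l0 n x" and t: "t \<ge> 0"
    and \<epsilon>: "\<And>n. \<epsilon> n \<ge> 0"
      "\<And>n. 2 ^ Suc n * (c11 * exp (t * 2 ^ Suc n - c12 * real (scale L0 l0 n) powr \<beta>)) \<le> \<epsilon> n"
  shows "mgf t n \<T> \<le>
    (1 + exp t * bond.prob p {\<omega> \<in> space (bond p). \<zeta>' 0 0 \<omega> = 1} + (\<Sum>i<n. \<epsilon> i)) ^ 2 ^ n"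
  using T
proof (induction n arbitrary: \<T> x)
  case 0
  then show ?case
    using mgf_0[OF 0 t] by simp
next
  case (Suc n)
  let ?a = "1 + exp t * bond.prob p {\<omega> \<in> space (bond p). \<zeta>' 0 0 \<omega> = 1} + (\<Sum>i<n. \<epsilon> i)"
  have a: "?a \<ge> 1"
    using \<epsilon>(1) by (simp add: sum_nonneg)
  have nn: "mgf t n \<U> \<ge> 0" for \<U>
    unfolding mgf_def by (intro integral_nonneg_AE) auto
  have "mgf t (Suc n) \<T> \<le> mgf t n (subtree n 1 \<T>) * mgf t n (subtree n 2 \<T>) + \<epsilon> n"
    using mgf_Suc[OF Suc.prems t] \<epsilon>(2)[of n] by linarith
  also have "\<dots> \<le> ?a ^ 2 ^ n * ?a ^ 2 ^ n + \<epsilon> n"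
    using a nn Suc.IH[OF subtree_in_embeddings[OF Suc.prems]]
    by (intro add_right_mono mult_mono) auto
  also have "\<dots> = ?a ^ 2 ^ Suc n + \<epsilon> n"
    by (simp add: power_add[symmetric] mult_2)
  also have "\<dots> \<le> (?a + \<epsilon> n) ^ 2 ^ Suc n"
    using a \<epsilon>(1) by (intro add_le_power_add) auto
  finally show ?case
    by (simp add: add.assoc)
qed

section \<open>Tail bounds, union bound and Borel-Cantelli\<close>

lemma tail_bound:
  fixes r :: real
  assumes T: "\<T> \<in> embeddings L0 l0 n x" and t: "t \<ge> 0"
  defines "A \<equiv> {\<omega> \<in> space (bond p). r \<le> (\<Sum>m\<in>tree_level n. real (\<zeta> (\<T> m) \<omega>))}"
  shows "A \<in> sets (bond p)"
    and "bond.prob p A \<le> exp (- t * r) * mgf t n \<T> +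
      2 ^ n * (c15 * exp (- c16 * real (scale L0 l0 n) powr \<beta>))"
proof -
  let ?I = "tree_level n"
  let ?S = "\<lambda>\<omega>. \<Sum>m\<in>?I. real (\<zeta>' n (\<T> m) \<omega>)"
  have lat: "\<T> m \<in> lat" if "m \<in> ?I" for m
    using embeddings_leaf[OF T that] .
  have "(\<lambda>\<omega>. \<Sum>m\<in>?I. real (\<zeta> (\<T> m) \<omega>)) \<in> borel_measurable (bond p)"
    using lat by (intro borel_measurable_sum field_measurable) auto
  then show A: "A \<in> sets (bond p)"
    unfolding A_def by measurable
  have "\<forall>m\<in>?I. \<exists>F. F \<in> sets (bond p) \<and> (\<forall>\<omega>\<in>F. \<zeta> (\<T> m) \<omega> = \<zeta>' n (\<T> m) \<omega>) \<and>
      bond.prob p (space (bond p) - F) \<le> c15 * exp (- c16 * real (scale L0 l0 n) powr \<beta>)"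
    using field'_limit[OF lat, of _ n] by blast
  from bchoice[OF this] obtain F where F: "\<And>m. m \<in> ?I \<Longrightarrow> F m \<in> sets (bond p)"
      "\<And>m \<omega>. m \<in> ?I \<Longrightarrow> \<omega> \<in> F m \<Longrightarrow> \<zeta> (\<T> m) \<omega> = \<zeta>' n (\<T> m) \<omega>"
      "\<And>m. m \<in> ?I \<Longrightarrow> bond.prob p (space (bond p) - F m) \<le>
        c15 * exp (- c16 * real (scale L0 l0 n) powr \<beta>)"
    by blast
  let ?J = "\<lambda>\<omega>. \<Sum>m\<in>?I. indicator (space (bond p) - F m) \<omega> :: real"
  \<comment> \<open>This dominates the indicator of \<open>A\<close> pointwise: the first term is at
    least 1 on \<open>A\<close> when \<open>\<zeta>\<close> agrees with the approximating field at
    all leaves (Markov), the second whenever some leaf is outside its agreement event.\<close>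
  let ?R = "\<lambda>\<omega>. exp (- t * r) * exp (t * ?S \<omega>) + ?J \<omega>"
  have int: "integrable (bond p) (\<lambda>\<omega>. exp (t * ?S \<omega>))"
    using lat t by (intro integrable_exp_sum) auto
  have intJ: "integrable (bond p) (indicator (space (bond p) - F m) :: _ \<Rightarrow> real)" if "m \<in> ?I" for m
    using F(1)[OF that] by (auto simp: bond.emeasure_eq_measure)
  have intJ': "integrable (bond p) ?J"
    using intJ by (intro Bochner_Integration.integrable_sum) auto
  have "bond.prob p A = bond.expectation p (indicator A)"
    using A by simp
  also have "\<dots> \<le> bond.expectation p ?R"
  proof (rule integral_mono)
    show "integrable (bond p) (indicator A :: _ \<Rightarrow> real)"
      using A by (auto simp: bond.emeasure_eq_measure)
    show "integrable (bond p) ?R"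
      using int intJ' by auto
    fix \<omega> :: "'d config" assume \<omega>: "\<omega> \<in> space (bond p)"
    have J0: "?J \<omega> \<ge> 0"
      by (intro sum_nonneg) auto
    show "indicator A \<omega> \<le> ?R \<omega>"
    proof (cases "\<omega> \<in> A \<and> (\<forall>m\<in>?I. \<omega> \<in> F m)")
      case True
      then have "(\<Sum>m\<in>?I. real (\<zeta> (\<T> m) \<omega>)) = ?S \<omega>"
        using F(2) by (intro sum.cong) auto
      then have "t * r \<le> t * ?S \<omega>"
        using True t by (intro mult_left_mono) (auto simp: A_def)
      then have "1 \<le> exp (- t * r) * exp (t * ?S \<omega>)"
        by (simp add: exp_add[symmetric])
      then show ?thesis
        using True J0 by simp
    next
      case False
      show ?thesis
      proof (cases "\<omega> \<in> A")
        case True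
        with False obtain m where m: "m \<in> ?I" "\<omega> \<notin> F m"
          by blast
        have "indicator (space (bond p) - F m) \<omega> \<le> ?J \<omega>"
          by (rule member_le_sum[OF m(1)]) auto
        then have "1 \<le> ?J \<omega>"
          using m \<omega> by simp
        then show ?thesis
          using True by (simp add: add_increasing)
      qed (use J0 in simp)
    qed
  qed
  also have "\<dots> = exp (- t * r) * mgf t n \<T> + bond.expectation p ?J"
    using int intJ' by (simp only: mgf_def Bochner_Integration.integral_add
        Bochner_Integration.integral_mult_right integrable_mult_right)
  also have "bond.expectation p ?J = (\<Sum>m\<in>?I. bond.prob p (space (bond p) - F m))"
    using intJ F(1) by (subst Bochner_Integration.integral_sum) (auto intro!: sum.cong)
  also have "\<dots> \<le> (\<Sum>m\<in>?I. c15 * exp (- c16 * real (scale L0 l0 n) powr \<beta>))"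
    using F(3) by (intro sum_mono) auto
  also have "\<dots> = 2 ^ n * (c15 * exp (- c16 * real (scale L0 l0 n) powr \<beta>))"
    by simp
  finally show "bond.prob p A \<le> exp (- t * r) * mgf t n \<T> +
      2 ^ n * (c15 * exp (- c16 * real (scale L0 l0 n) powr \<beta>))"
    by simp
qed

text \<open>This is the probabilistic argument with the choice of constants factored out:
  \<open>\<epsilon>\<close> dominates the one-step errors, and \<open>le_C\<close> keeps the base of
  the moment bound below \<open>C\<close> at every depth.\<close>

lemma AE_density_less:
  fixes \<rho> t :: real and \<epsilon> :: "nat \<Rightarrow> real" and D :: "nat \<Rightarrow> (int ^ 'd) set"
  defines "C \<equiv> embedding_const CARD('d) l0"
  assumes t: "t \<ge> 0" "t * \<rho> = 3 * ln C"
    and l0\<beta>: "3 \<le> real l0 powr \<beta>" and c: "c15 > 0" "c16 > 0"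
    and \<epsilon>: "\<And>n. \<epsilon> n \<ge> 0"
      "\<And>n. 2 ^ Suc n * (c11 * exp (t * 2 ^ Suc n - c12 * real (scale L0 l0 n) powr \<beta>)) \<le> \<epsilon> n"
    and le_C: "\<And>n. 1 + exp t * bond.prob p {\<omega> \<in> space (bond p). \<zeta>' 0 0 \<omega> = 1} + (\<Sum>i<n. \<epsilon> i) \<le> C"
    and D: "\<And>n. n \<ge> 1 \<Longrightarrow> finite (D n)" "\<And>n. n \<ge> 1 \<Longrightarrow> D n \<subseteq> scaled_lattice L0 l0 n"
    and D_lim: "(\<lambda>n. ln (real (card (D n))) / 2 ^ n) \<longlonglongrightarrow> 0"
  shows "AE \<omega> in bond p. \<forall>\<^sub>F n in sequentially.
    (SUP x\<in>D n. SUP \<T>\<in>embeddings L0 l0 n x.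
      ereal ((\<Sum>m\<in>tree_level n. real (\<zeta> (\<T> m) \<omega>)) / 2 ^ n)) < ereal \<rho>"
proof -
  have C4: "C \<ge> 4"
    unfolding C_def using l0 by (intro embedding_const_ge) (simp_all add: Suc_le_eq)
  \<comment> \<open>Budget in units of \<open>K * 2 ^ n\<close>: the roots eventually cost at most
    1, the embeddings 2 and the exponential moment 2, whereas \<open>t * \<rho> = 3 * ln C\<close>
    gains 6. One unit of decay is left.\<close>
  define K where "K = ln C / 2"
  have K: "K > 0"
    using C4 by (simp add: K_def)
  have C_eq: "C = exp (2 * K)"
    using C4 by (simp add: K_def)
  define a where "a = c16 * real L0 powr \<beta>"
  have a: "a > 0"
    using c L0 by (simp add: a_def)
  define \<delta> where "\<delta> n = exp (- 4 * K * 2 ^ n) + 2 ^ n * (c15 * exp (- a * 3 ^ n))" for n :: nat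
  have \<delta>0: "\<delta> n \<ge> 0" for n
    using c by (simp add: \<delta>_def)
  \<comment> \<open>The inequality is not strict, so that avoiding the bad event gives the strict
    bound of the conclusion.\<close>
  define Bad1 where "Bad1 n \<T> = {\<omega> \<in> space (bond p).
    \<rho> * 2 ^ n \<le> (\<Sum>m\<in>tree_level n. real (\<zeta> (\<T> m) \<omega>))}" for n \<T>
  define Bad where "Bad n = (\<Union>x\<in>D n. \<Union>\<T>\<in>embeddings L0 l0 n x. Bad1 n \<T>)" for n
  have Bad1_sets: "Bad1 n \<T> \<in> sets (bond p)" if "\<T> \<in> embeddings L0 l0 n x" for n \<T> x
    unfolding Bad1_def by (rule tail_bound(1)[OF that t(1)])
  have Bad1_prob: "bond.prob p (Bad1 n \<T>) \<le> \<delta> n" if T: "\<T> \<in> embeddings L0 l0 n x" for n \<T> x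
  proof -
    have "mgf t n \<T> \<le> C ^ 2 ^ n"
    proof (rule order.trans[OF mgf_bound[OF T t(1) \<epsilon>]])
      show "(1 + exp t * bond.prob p {\<omega> \<in> space (bond p). \<zeta>' 0 0 \<omega> = 1} + (\<Sum>i<n. \<epsilon> i)) ^ 2 ^ n
          \<le> C ^ 2 ^ n"
        by (intro power_mono le_C add_nonneg_nonneg sum_nonneg \<epsilon>(1)) auto
    qed
    also have "\<dots> = exp (2 * K * 2 ^ n)"
      by (simp add: C_eq exp_of_nat_mult[symmetric] mult_ac)
    finally have "exp (- t * (\<rho> * 2 ^ n)) * mgf t n \<T> \<le> exp (- t * (\<rho> * 2 ^ n)) * exp (2 * K * 2 ^ n)"
      by (intro mult_left_mono) auto
    also have "\<dots> = exp (- (t * \<rho>) * 2 ^ n) * exp (2 * K * 2 ^ n)"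
      by simp
    also have "\<dots> = exp (- (6 * K) * 2 ^ n) * exp (2 * K * 2 ^ n)"
      unfolding t(2) by (simp add: K_def)
    also have "exp (- (6 * K) * 2 ^ n) * exp (2 * K * 2 ^ n) = exp (- 4 * K * 2 ^ n)"
      by (simp add: exp_add[symmetric])
    finally have 1: "exp (- t * (\<rho> * 2 ^ n)) * mgf t n \<T> \<le> exp (- 4 * K * 2 ^ n)"
      by simp
    have "a * 3 ^ n \<le> c16 * real (scale L0 l0 n) powr \<beta>"
      using scale_powr_ge[OF l0\<beta>, of L0 n] c by (simp add: a_def mult.assoc)
    then have "2 ^ n * (c15 * exp (- c16 * real (scale L0 l0 n) powr \<beta>)) \<le>
        2 ^ n * (c15 * exp (- a * 3 ^ n))"
      using c by (intro mult_left_mono) auto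
    with 1 show ?thesis
      unfolding Bad1_def \<delta>_def by (intro order.trans[OF tail_bound(2)[OF T t(1)]] add_mono)
  qed
  have emb: "finite (embeddings L0 l0 n x)" "real (card (embeddings L0 l0 n x)) \<le> C ^ 2 ^ n"
    if "x \<in> D n" "n \<ge> 1" for n x
  proof -
    have *: "finite (embeddings L0 l0 n x) \<and> real (card (embeddings L0 l0 n x)) \<le> C ^ (2 ^ n - 1)"
      unfolding C_def using that D(2) L0 l0 by (intro finite_card_embeddings) auto
    then show "finite (embeddings L0 l0 n x)"
      by blast
    have "C ^ (2 ^ n - 1) \<le> C ^ 2 ^ n"
      using C4 by (intro power_increasing) auto
    with * show "real (card (embeddings L0 l0 n x)) \<le> C ^ 2 ^ n"
      by linarith
  qed
  have Bad_sets: "Bad n \<in> sets (bond p)" if "n \<ge> 1" for n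
    unfolding Bad_def using that D(1) emb(1) Bad1_sets by (intro sets.finite_UN) auto
  have Bad_prob: "bond.prob p (Bad n) \<le> real (card (D n)) * (C ^ 2 ^ n * \<delta> n)" if n: "n \<ge> 1" for n
  proof -
    have "bond.prob p (Bad n) \<le>
        (\<Sum>x\<in>D n. bond.prob p (\<Union>\<T>\<in>embeddings L0 l0 n x. Bad1 n \<T>))"
      unfolding Bad_def using D(1)[OF n] emb(1)[OF _ n] Bad1_sets
      by (intro bond.finite_measure_subadditive_finite) auto
    also have "\<dots> \<le> (\<Sum>x\<in>D n. C ^ 2 ^ n * \<delta> n)"
    proof (rule sum_mono)
      fix x assume x: "x \<in> D n"
      have "bond.prob p (\<Union>\<T>\<in>embeddings L0 l0 n x. Bad1 n \<T>) \<le>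
          (\<Sum>\<T>\<in>embeddings L0 l0 n x. bond.prob p (Bad1 n \<T>))"
        using emb(1)[OF x n] Bad1_sets by (intro bond.finite_measure_subadditive_finite) auto
      also have "\<dots> \<le> (\<Sum>\<T>\<in>embeddings L0 l0 n x. \<delta> n)"
        using Bad1_prob by (intro sum_mono) auto
      also have "\<dots> \<le> C ^ 2 ^ n * \<delta> n"
        using mult_right_mono[OF emb(2)[OF x n] \<delta>0] by simp
      finally show "bond.prob p (\<Union>\<T>\<in>embeddings L0 l0 n x. Bad1 n \<T>) \<le> C ^ 2 ^ n * \<delta> n" .
    qed
    finally show ?thesis
      by simp
  qed
  have "\<forall>\<^sub>F n in sequentially. ln (real (card (D n))) / 2 ^ n < K"
    using D_lim K by (rule order_tendstoD(2))
  then have card_D: "\<forall>\<^sub>F n in sequentially. real (card (D n)) \<le> exp (K * 2 ^ n)"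
  proof eventually_elim
    case (elim n)
    \<comment> \<open>An empty \<open>D n\<close> is treated apart, since \<open>exp\<close> does
      not invert \<open>ln\<close> at 0.\<close>
    show ?case
    proof (cases "card (D n) = 0")
      case False
      then have "real (card (D n)) = exp (ln (real (card (D n))))"
        by simp
      also have "\<dots> \<le> exp (K * 2 ^ n)"
        using elim by (simp add: divide_less_eq)
      finally show ?thesis .
    qed simp
  qed
  have sum_Bad: "summable (\<lambda>n. bond.prob p (Bad n))"
  proof (rule summable_comparison_test_ev)
    show "summable (\<lambda>n. exp (- K * 2 ^ n) + exp (3 * K * 2 ^ n) * (2 ^ n * (c15 * exp (- a * 3 ^ n))))"
      using summable_tail_errors[OF K a] .
    show "\<forall>\<^sub>F n in sequentially. norm (bond.prob p (Bad n)) \<le>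
        exp (- K * 2 ^ n) + exp (3 * K * 2 ^ n) * (2 ^ n * (c15 * exp (- a * 3 ^ n)))"
      using card_D eventually_ge_at_top[of 1]
    proof eventually_elim
      case (elim n)
      have "bond.prob p (Bad n) \<le> exp (K * 2 ^ n) * (C ^ 2 ^ n * \<delta> n)"
        using \<delta>0[of n] C4 by (intro order.trans[OF Bad_prob[OF elim(2)]] mult_right_mono elim(1)) simp
      also have "\<dots> = exp (K * 2 ^ n) * C ^ 2 ^ n * \<delta> n"
        by simp
      also have "exp (K * 2 ^ n) * C ^ 2 ^ n = exp (3 * K * 2 ^ n)"
        by (simp add: C_eq exp_of_nat_mult[symmetric] exp_add[symmetric] mult_ac)
      also have "exp (3 * K * 2 ^ n) * \<delta> n = exp (- K * 2 ^ n) +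
          exp (3 * K * 2 ^ n) * (2 ^ n * (c15 * exp (- a * 3 ^ n)))"
        by (simp add: \<delta>_def distrib_left exp_add[symmetric])
      finally show ?case
        by simp
    qed
  qed
  \<comment> \<open>The index is shifted because nothing is assumed about \<open>D 0\<close>, so
    \<open>Bad 0\<close> need not be measurable.\<close>
  have "AE \<omega> in bond p. \<forall>\<^sub>F n in sequentially. \<omega> \<in> space (bond p) - Bad (Suc n)"
  proof (rule borel_cantelli_AE1)
    show "summable (\<lambda>n. bond.prob p (Bad (Suc n)))"
      using summable_ignore_initial_segment[OF sum_Bad, of 1] by simp
  qed (use Bad_sets in \<open>auto simp: bond.emeasure_eq_measure\<close>)
  then show ?thesis
  proof (rule AE_mp, intro AE_I2 impI)
    fix \<omega> :: "'d config"
    assume "\<forall>\<^sub>F n in sequentially. \<omega> \<in> space (bond p) - Bad (Suc n)"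
    then have "\<forall>\<^sub>F n in sequentially. \<omega> \<in> space (bond p) - Bad n"
      by (simp only: eventually_sequentially_Suc[where P = "\<lambda>n. \<omega> \<in> space (bond p) - Bad n"])
    then show "\<forall>\<^sub>F n in sequentially. (SUP x\<in>D n. SUP \<T>\<in>embeddings L0 l0 n x.
        ereal ((\<Sum>m\<in>tree_level n. real (\<zeta> (\<T> m) \<omega>)) / 2 ^ n)) < ereal \<rho>"
      using eventually_ge_at_top[of 1]
    proof eventually_elim
      case (elim n)
      show ?case
      proof (intro SUP_less_finite)
        fix x \<T> assume "x \<in> D n" "\<T> \<in> embeddings L0 l0 n x"
        then have "\<omega> \<notin> Bad1 n \<T>"
          using elim(1) by (auto simp: Bad_def)
        then show "ereal ((\<Sum>m\<in>tree_level n. real (\<zeta> (\<T> m) \<omega>)) / 2 ^ n) < ereal \<rho>"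
          using elim(1) by (simp add: Bad1_def divide_less_eq)
      qed (use D(1) emb(1) elim(2) in auto)
    qed
  qed
qed

end

section \<open>Choice of the constants\<close>

theorem theorem3p9:
  fixes p \<beta> c11 c12 c15 c16 :: real
  assumes "CARD('d::finite) \<ge> 2"
    and "p_crit TYPE('d) < p" and "p < 1"
    and "\<beta> > 0" and "c11 > 0" and "c12 > 0" and "c15 > 0" and "c16 > 0"
  shows "\<exists>c13 > 0. \<exists>c14 > 0. \<exists>c > 0.
    \<forall>(\<rho>::real) (l0::nat) (L0::nat) (t::real) (C::real) (\<theta>::real)
      (\<zeta> :: int ^ 'd \<Rightarrow> 'd config \<Rightarrow> nat) (\<zeta>' :: nat \<Rightarrow> int ^ 'd \<Rightarrow> 'd config \<Rightarrow> nat)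
      (D :: nat \<Rightarrow> (int ^ 'd) set).
      0 < \<rho> \<longrightarrow> \<rho> < 1 \<longrightarrow>
      real l0 \<ge> max (3 powr (1 / \<beta>)) 100 \<longrightarrow> L0 \<ge> 1 \<longrightarrow>
      C = embedding_const CARD('d) l0 \<longrightarrow>
      t = 3 * inverse \<rho> * ln C \<longrightarrow>
      approximable_by p L0 l0 \<beta> c11 c12 c15 c16 \<zeta> \<zeta>' \<longrightarrow>
      \<theta> = measure (bond p) {\<omega> \<in> space (bond p). \<zeta>' 0 0 \<omega> = 1} \<longrightarrow>
      ln (1 + exp t * (\<theta> + c13 * exp (- c14 * real L0 powr \<beta>))) \<le> ln C \<longrightarrow>
      t - t * \<rho> - c * real L0 powr \<beta> \<le> - 3 * ln C \<longrightarrow>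
      (\<forall>n\<ge>1. finite (D n) \<and> D n \<subseteq> scaled_lattice L0 l0 n) \<longrightarrow>
      (\<lambda>n. ln (real (card (D n))) / 2 ^ n) \<longlonglongrightarrow> 0 \<longrightarrow>
      (AE \<omega> in bond p. \<forall>\<^sub>F n in sequentially.
        (SUP x\<in>D n. SUP \<T>\<in>embeddings L0 l0 n x.
          ereal ((\<Sum>m\<in>tree_level n. real (\<zeta> (\<T> m) \<omega>)) / 2 ^ n)) < ereal \<rho>)"
proof -
  \<comment> \<open>With s the power \<open>real L0 powr \<beta>\<close>, the one-step error at
    depth \<open>n\<close> will be at most \<open>g n\<close> times c11 exp (- (c12 / 2) s). Summing
    over all depths dictates \<open>c13\<close> below and c14 = c12 / 2.\<close>
  define g where "g n = 2 ^ Suc n * exp (- (c12 / 2) * (3 ^ n - 1))" for n :: nat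
  have g0: "g n > 0" for n
    by (simp add: g_def)
  have g_sum: "summable g"
    unfolding g_def using assms by (intro summable_moment_errors) simp
  define c13 where "c13 = c11 * suminf g"
  have c13: "c13 > 0"
    using assms g0 suminf_pos[OF g_sum] by (simp add: c13_def)
  \<comment> \<open>The value c12 / 4 for c makes t 2^{n+1} at most (c12 / 2) s 2^n, which uses up
    only half of the decay c12 s 3^n. The other half yields both c14 and the summability of
    \<open>g\<close>.\<close>
  have c: "c12 / 2 > 0" "c12 / 4 > 0"
    using assms by simp_all
  show ?thesis
  proof (rule exI[of _ c13], rule conjI[OF c13], rule exI[of _ "c12 / 2"], rule conjI[OF c(1)],
      rule exI[of _ "c12 / 4"], rule conjI[OF c(2)], intro allI impI)
    fix \<rho> t C \<theta> :: real and l0 L0 :: nat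
      and \<zeta> :: "int ^ 'd \<Rightarrow> 'd config \<Rightarrow> nat" and \<zeta>' :: "nat \<Rightarrow> int ^ 'd \<Rightarrow> 'd config \<Rightarrow> nat"
      and D :: "nat \<Rightarrow> (int ^ 'd) set"
    assume \<rho>: "0 < \<rho>" "\<rho> < 1" and l0_ge: "max (3 powr (1 / \<beta>)) 100 \<le> real l0" and L0: "1 \<le> L0"
      and C: "C = embedding_const CARD('d) l0" and t: "t = 3 * inverse \<rho> * ln C"
      and approx: "approximable_by p L0 l0 \<beta> c11 c12 c15 c16 \<zeta> \<zeta>'"
      and \<theta>: "\<theta> = measure (bond p) {\<omega> \<in> space (bond p). \<zeta>' 0 0 \<omega> = 1}"
      and cond1: "ln (1 + exp t * (\<theta> + c13 * exp (- (c12 / 2) * real L0 powr \<beta>))) \<le> ln C"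
      and cond2: "t - t * \<rho> - c12 / 4 * real L0 powr \<beta> \<le> - 3 * ln C"
      and D: "\<forall>n\<ge>1. finite (D n) \<and> D n \<subseteq> scaled_lattice L0 l0 n"
      and D_lim: "(\<lambda>n. ln (real (card (D n))) / 2 ^ n) \<longlonglongrightarrow> 0"
    interpret approximable_field p \<beta> c11 c12 c15 c16 L0 l0 \<zeta> \<zeta>'
      using approx L0 l0_ge by unfold_locales auto
    have "3 = (3 powr (1 / \<beta>)) powr \<beta>"
      using assms by (simp add: powr_powr)
    also have "\<dots> \<le> real l0 powr \<beta>"
      using assms(4) l0_ge by (intro powr_mono2) auto
    finally have l0\<beta>: "3 \<le> real l0 powr \<beta>" .
    have C4: "C \<ge> 4"
      unfolding C using l0 by (intro embedding_const_ge) (simp_all add: Suc_le_eq)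
    have t0: "t \<ge> 0" and t\<rho>: "t * \<rho> = 3 * ln C"
      using \<rho> C4 by (simp_all add: t field_simps)
    define s where "s = real L0 powr \<beta>"
    have s: "s \<ge> 1"
      using L0 assms by (simp add: s_def ge_one_powr_ge_zero)
    \<comment> \<open>Since \<open>t * \<rho> = 3 * ln C\<close>, the second hypothesis says no more than this.\<close>
    have ts: "t \<le> c12 / 4 * s"
      using cond2 t\<rho> by (simp add: s_def)
    define \<epsilon> where "\<epsilon> n = c11 * exp (- (c12 / 2) * s) * g n" for n
    have \<epsilon>0: "\<epsilon> n \<ge> 0" for n
      using assms g0[of n] by (simp add: \<epsilon>_def)
    have \<epsilon>: "2 ^ Suc n * (c11 * exp (t * 2 ^ Suc n - c12 * real (scale L0 l0 n) powr \<beta>)) \<le> \<epsilon> n" for n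
    proof -
      have "t * 2 ^ Suc n \<le> c12 / 4 * s * 2 ^ Suc n"
        using ts by (intro mult_right_mono) auto
      also have "\<dots> = c12 / 2 * s * 2 ^ n"
        by simp
      also have "\<dots> \<le> c12 / 2 * s * 3 ^ n"
        using s assms by (intro mult_left_mono power_mono) auto
      finally have 1: "t * 2 ^ Suc n \<le> c12 / 2 * (s * 3 ^ n)"
        by simp
      have 2: "c12 * (s * 3 ^ n) \<le> c12 * real (scale L0 l0 n) powr \<beta>"
        using scale_powr_ge[OF l0\<beta>, of L0 n] assms by (simp add: s_def)
      \<comment> \<open>Since s \<ge> 1, the product s 3^n is at least s + (3^n - 1). This separates
        the dependence on \<open>L0\<close> from the dependence on the depth.\<close>
      have "1 * (3 ^ n - 1) \<le> s * (3 ^ n - 1)"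
        using s by (intro mult_right_mono) auto
      then have "s + (3 ^ n - 1) \<le> s * 3 ^ n"
        by (simp add: algebra_simps)
      then have "c12 / 2 * (s + (3 ^ n - 1)) \<le> c12 / 2 * (s * 3 ^ n)"
        using assms by (intro mult_left_mono) auto
      with 1 2 have "t * 2 ^ Suc n - c12 * real (scale L0 l0 n) powr \<beta> \<le>
          - (c12 / 2) * s + - (c12 / 2) * (3 ^ n - 1)"
        by (simp add: algebra_simps)
      then have "exp (t * 2 ^ Suc n - c12 * real (scale L0 l0 n) powr \<beta>) \<le>
          exp (- (c12 / 2) * s) * exp (- (c12 / 2) * (3 ^ n - 1))"
        by (simp only: exp_add[symmetric] exp_le_cancel_iff)
      then have "2 ^ Suc n * (c11 * exp (t * 2 ^ Suc n - c12 * real (scale L0 l0 n) powr \<beta>)) \<le>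
          2 ^ Suc n * (c11 * (exp (- (c12 / 2) * s) * exp (- (c12 / 2) * (3 ^ n - 1))))"
        using assms by (intro mult_left_mono) auto
      also have "\<dots> = \<epsilon> n"
        by (simp only: \<epsilon>_def g_def mult_ac)
      finally show ?thesis .
    qed
    have le_C: "1 + exp t * bond.prob p {\<omega> \<in> space (bond p). \<zeta>' 0 0 \<omega> = 1} + (\<Sum>i<n. \<epsilon> i) \<le> C" for n
    proof -
      have "(\<Sum>i<n. \<epsilon> i) = c11 * exp (- (c12 / 2) * s) * (\<Sum>i<n. g i)"
        by (simp add: \<epsilon>_def sum_distrib_left)
      also have "\<dots> \<le> c11 * exp (- (c12 / 2) * s) * suminf g"
        using assms g0 by (intro mult_left_mono sum_le_suminf g_sum) (auto simp: less_imp_le)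
      also have "\<dots> = 1 * (c13 * exp (- (c12 / 2) * s))"
        by (simp add: c13_def)
      \<comment> \<open>Inserting the factor \<open>exp t \<ge> 1\<close> brings the total error
        into the form in which it appears in the first numerical hypothesis, next to
        \<open>\<theta>\<close>.\<close>
      also have "\<dots> \<le> exp t * (c13 * exp (- (c12 / 2) * s))"
        using t0 c13 by (intro mult_right_mono) auto
      finally have "1 + exp t * \<theta> + (\<Sum>i<n. \<epsilon> i) \<le> 1 + exp t * (\<theta> + c13 * exp (- (c12 / 2) * s))"
        by (simp add: distrib_left)
      also have "\<dots> \<le> C"
      proof -
        have "0 < 1 + exp t * (\<theta> + c13 * exp (- (c12 / 2) * s))"
          using c13 by (intro add_pos_nonneg mult_nonneg_nonneg add_nonneg_nonneg) (auto simp: \<theta>)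
        then show ?thesis
          using cond1 C4 unfolding s_def by (subst (asm) ln_le_cancel_iff) auto
      qed
      finally show ?thesis
        by (simp only: \<theta>)
    qed
    show "AE \<omega> in bond p. \<forall>\<^sub>F n in sequentially.
        (SUP x\<in>D n. SUP \<T>\<in>embeddings L0 l0 n x.
          ereal ((\<Sum>m\<in>tree_level n. real (\<zeta> (\<T> m) \<omega>)) / 2 ^ n)) < ereal \<rho>"
      using D D_lim assms
      by (intro AE_density_less[OF t0 t\<rho>[unfolded C] l0\<beta> _ _ \<epsilon>0 \<epsilon> le_C[unfolded C]]) auto
  qed
qed

end
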